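(* Let $L_1$ and $L_2$ be two non isotopic (classical) links distinguished by $\mathcal{F}'$ but not by the Homflypt polynomial $P$. Then any pair of singular links obtained by adding to $L_r$ ($r=1,2$) a new component making a singular crossing and a negative crossing with whatever component of $L_r$ is distinguished by $\Phi'_{x,y}$ and by $\Psi'_{x,y}$ but not by $\mathrm{I}_{PR}$.
   Context: Links are oriented. A singular link is a link in $\mathbb{R}^3$ admitting simple singular double points; its components are those of the classical link obtained by replacing each singular point by a positive crossing. A cts-link is a pair $(L,J)$, $L$ a singular link with $k$ numbered components and $J$ a set partition of $\{1,\dots,k\}$ (the components), up to isotopy of singular links carrying partition to partition. $\mathbf{1}_k$ is the partition into singletons. For an invariant $\mathrm{I}$ of cts-links, two (singular) links $L,L'$ with $k$ components are distinguished by $\mathrm{I}$ if $\mathrm{I}(L,\mathbf{1}_k)\ne\mathrm{I}(L',\mathbf{1}_k)$; for $P$ and $\mathrm{I}_{PR}$, if the values on $L$, $L'$ differ. The new component is a small unknotted circle whose only crossings with the rest of the diagram are two crossings with one strand of the chosen component of $L_r$, one singular and one negative (so replacing the singular crossing by a positive one unlinks the circle, and smoothing the singular crossing gives back $L_r$ up to isotopy). Let $v,a,b,x,y$ be variables, $d=\frac{a+(1-v^2)b}{a}$; values lie in a field containing $\mathbb{C}(v,a,b,x,y)$ and $\sqrt d$. Notation: $(L_+,J),(L_-,J),(L_\times,J)$ are cts-links with diagrams identical except at one crossing, respectively positive, negative, singular; $J'$ is obtained from $J$ by merging the blocks containing the two components at the crossing ($J'=J$ if they are in the same block); $L_0$ is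 the oriented smoothing, and $J''$ is the partition of the components of $L_0$ induced by $J'$ (components through the smoothed strands lie in the merged block). $O$ is an unlinked unknot. $\Phi'_{x,y}$ and $\Psi'_{x,y}$ are the invariants of cts-links determined by the common rules (for $\mathrm{I}=\Phi'_{x,y},\Psi'_{x,y}$): I: value $1$ on the unknot; II: $\mathrm{I}(L\sqcup O,\iota(J))=\frac{v}{a\sqrt d}\mathrm{I}(L,J)$, where $\iota(J)$ is $J$ with the new component added as a singleton block; III': $\frac{1}{\sqrt d}\mathrm{I}(L_+,J)-\sqrt d\,\mathrm{I}(L_-,J)=(v-v^{-1})\mathrm{I}(L_0,J'')$; and respectively $\Phi'_{x,y}(L_\times,J)=x\Phi'_{x,y}(L_0,J'')+y\Phi'_{x,y}(L_+,J')$, $\Psi'_{x,y}(L_\times,J)=x\Psi'_{x,y}(L_0,J'')+y\Psi'_{x,y}(L_+,J)$. $\mathcal{F}'$ is the invariant of (nonsingular) combinatoric tied links determined by rules I, II, III'; it is the common restriction of $\Phi'_{x,y}$ and $\Psi'_{x,y}$ to nonsingular links. $P$ is the Homflypt polynomial of classical links; up to renaming of variables it is given by $P(O)=1$ and $\frac{1}{\sqrt d}P(L_+)-\sqrt d\,P(L_-)=(v-v^{-1})P(L_0)$, i.e. $P(L)=\mathcal{F}'(L,I)$ with $I$ the partition with a unique block. $\mathrm{I}_{PR}$ is the Paris–Rabenda polynomial invariant of singular links; up to renaming of variables it coincides with $P$ on classical links and satisfies $\mathrm{I}_{PR}(L_\times)=x\,\mathrm{I}_{PR}(L_0)+y\,\mathrm{I}_{PR}(L_+)$.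 *)

theory Defs
  imports
    Complex_Main
    "HOL-Library.Disjoint_Sets"
    "HOL-Computational_Algebra.Computational_Algebra"
begin

text \<open>
  Oriented singular links are given by oriented planar diagrams, taken up to the singular
  Reidemeister moves.  Turn a crossing so that both of its strands run upwards.  The strand
  \<open>Rightward\<close> then runs from south-west to north-east and the strand \<open>Leftward\<close> from south-east to
  north-west.  With this convention the three kinds of crossing share the same underlying graph:
  at a positive crossing \<open>Rightward\<close> is the over strand, at a negative one \<open>Leftward\<close> is, and at a
  singular one the two strands meet in a double point.
\<close>

datatype kind = Pos | Neg | Sing
datatype dir = Rightward | Leftward
datatype side = Lft | Rgt

fun opp :: "dir \<Rightarrow> dir" where
  "opp Rightward = Leftward"
| "opp Leftward = Rightward"

text \<open>
  A passage \<open>(c, h)\<close> is the passage of strand \<open>h\<close> through crossing \<open>c\<close>; it is entered along the arc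
  \<open>src (c, h)\<close> and left along the arc \<open>tgt (c, h)\<close>.  Arcs end at every crossing,
  at over passages as well; an arc that is not attached to any crossing is a circle without
  crossings.
\<close>

record diagram =
  arcs :: "nat set"
  crossings :: "nat set"
  kind :: "nat \<Rightarrow> kind"
  src :: "nat \<times> dir \<Rightarrow> nat"
  tgt :: "nat \<times> dir \<Rightarrow> nat"

definition classes :: "'a set \<Rightarrow> ('a \<times> 'a) set \<Rightarrow> 'a set set" where
  "classes A r = A // (r \<union> r\<inverse>)\<^sup>*"

definition components :: "diagram \<Rightarrow> nat set set" where
  "components D = classes (arcs D) {(src D (c, h), tgt D (c, h)) | c h. c \<in> crossings D}"

text \<open>The connected components of the diagram as a subset of the plane.\<close>

definition pieces :: "diagram \<Rightarrow> nat set set" where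
  "pieces D = classes (arcs D)
     ({(src D (c, h), tgt D (c, h)) | c h. c \<in> crossings D} \<union>
      {(src D (c, Rightward), src D (c, Leftward)) | c. c \<in> crossings D})"

text \<open>
  The two sides of the arcs that meet in the north, east, south and west sector of a crossing.
  The faces are the classes of arc sides generated by this relation.
\<close>

definition corners :: "diagram \<Rightarrow> ((nat \<times> side) \<times> (nat \<times> side)) set" where
  "corners D = (\<Union>c\<in>crossings D.
     {((tgt D (c, Leftward), Rgt), (tgt D (c, Rightward), Lft)),
      ((tgt D (c, Rightward), Rgt), (src D (c, Leftward), Rgt)),
      ((src D (c, Rightward), Rgt), (src D (c, Leftward), Lft)),
      ((tgt D (c, Leftward), Lft), (src D (c, Rightward), Lft))})"

definition faces :: "diagram \<Rightarrow> (nat \<times> side) set set" where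
  "faces D = classes (arcs D \<times> UNIV) (corners D)"

text \<open>
  Planarity is Euler's formula, summed over the pieces.  A piece with \<open>V > 0\<close> crossings has \<open>2 V\<close>
  arcs, so that genus zero means \<open>V - 2 V + F = 2\<close>; a circle without crossings has \<open>F = 2\<close>.  Each
  piece contributes at most this number of faces, so the equation for the sum says that every
  piece is planar.  The relative position of the pieces is not recorded, since a link with a
  disconnected diagram is the split union of its pieces in whatever way these are placed.
\<close>

definition link_diagram :: "diagram \<Rightarrow> bool" where
  "link_diagram D \<longleftrightarrow>
     finite (arcs D) \<and> arcs D \<noteq> {} \<and> finite (crossings D) \<and>
     inj_on (src D) (crossings D \<times> UNIV) \<and> inj_on (tgt D) (crossings D \<times> UNIV) \<and>
     src D ` (crossings D \<times> UNIV) = tgt D ` (crossings D \<times> UNIV) \<and>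
     src D ` (crossings D \<times> UNIV) \<subseteq> arcs D \<and>
     card (faces D) = card (crossings D) + 2 * card (pieces D)"

definition classical :: "diagram \<Rightarrow> bool" where
  "classical D \<longleftrightarrow> (\<forall>c\<in>crossings D. kind D c \<noteq> Sing)"

definition set_kind :: "diagram \<Rightarrow> nat \<Rightarrow> kind \<Rightarrow> diagram" where
  "set_kind D c k = D\<lparr>kind := (kind D)(c := k)\<rparr>"

definition add_unknot :: "diagram \<Rightarrow> nat \<Rightarrow> diagram" where
  "add_unknot D u = D\<lparr>arcs := insert u (arcs D)\<rparr>"

text \<open>
  \<open>D'\<close> arises from \<open>D\<close> by removing the crossings in \<open>S\<close> and gluing the arcs along the pairs in \<open>G\<close>;
  \<open>f\<close> sends each arc of \<open>D\<close> to the arc of \<open>D'\<close> of which it has become a part.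
\<close>

definition resolves :: "diagram \<Rightarrow> nat set \<Rightarrow> (nat \<times> nat) set \<Rightarrow> diagram \<Rightarrow> (nat \<Rightarrow> nat) \<Rightarrow> bool" where
  "resolves D S G D' f \<longleftrightarrow>
     f ` arcs D = arcs D' \<and> crossings D' = crossings D - S \<and>
     (\<forall>c\<in>crossings D'. kind D' c = kind D c \<and>
        (\<forall>h. src D' (c, h) = f (src D (c, h)) \<and> tgt D' (c, h) = f (tgt D (c, h)))) \<and>
     (\<forall>e\<in>arcs D. \<forall>e'\<in>arcs D. f e = f e' \<longleftrightarrow> (e, e') \<in> (G \<union> G\<inverse>)\<^sup>*)"

text \<open>The oriented smoothing: each strand leaves along the outgoing arc of the other one.\<close>

definition smoothing :: "diagram \<Rightarrow> nat \<Rightarrow> diagram \<Rightarrow> (nat \<Rightarrow> nat) \<Rightarrow> bool" where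
  "smoothing D c D' f \<longleftrightarrow> resolves D {c} {(src D (c, h), tgt D (c, opp h)) | h. True} D' f"

text \<open>Here each strand goes straight on, as if the crossings were virtual.\<close>

definition erases :: "diagram \<Rightarrow> nat set \<Rightarrow> diagram \<Rightarrow> (nat \<Rightarrow> nat) \<Rightarrow> bool" where
  "erases D S D' f \<longleftrightarrow> resolves D S {(src D (c, h), tgt D (c, h)) | c h. c \<in> S} D' f"


text \<open>
  Each move comes with the map \<open>f\<close> that follows the arcs, and hence the components.
\<close>

definition relabels :: "diagram \<Rightarrow> diagram \<Rightarrow> (nat \<Rightarrow> nat) \<Rightarrow> bool" where
  "relabels D D' f \<longleftrightarrow> bij_betw f (arcs D) (arcs D') \<and>
     (\<exists>g. bij_betw g (crossings D) (crossings D') \<and>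
       (\<forall>c\<in>crossings D. kind D' (g c) = kind D c \<and>
         (\<forall>h. src D' (g c, h) = f (src D (c, h)) \<and> tgt D' (g c, h) = f (tgt D (c, h)))))"

text \<open>
  First move: a strand that returns at once to the crossing it has left bounds a monogon.
\<close>

definition move1 :: "diagram \<Rightarrow> diagram \<Rightarrow> (nat \<Rightarrow> nat) \<Rightarrow> bool" where
  "move1 D D' f \<longleftrightarrow> (\<exists>c\<in>crossings D. \<exists>h.
     kind D c \<noteq> Sing \<and> tgt D (c, h) = src D (c, opp h) \<and> erases D {c} D' f)"

definition joins :: "diagram \<Rightarrow> nat \<Rightarrow> nat \<Rightarrow> nat \<Rightarrow> bool" where
  "joins D m c c' \<longleftrightarrow> (\<exists>h h'.
     tgt D (c, h) = m \<and> src D (c', h') = m \<or> tgt D (c', h') = m \<and> src D (c, h) = m)"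

definition bigon :: "diagram \<Rightarrow> nat \<Rightarrow> nat \<Rightarrow> bool" where
  "bigon D c c' \<longleftrightarrow> c \<in> crossings D \<and> c' \<in> crossings D \<and> c \<noteq> c' \<and>
     (\<exists>m m' z z'. m \<noteq> m' \<and> {(m, z), (m', z')} \<in> faces D \<and> joins D m c c' \<and> joins D m' c c')"

text \<open>
  Second move.  In a bigon a strand that is \<open>Rightward\<close> at one corner is \<open>Leftward\<close> at the other,
  so opposite signs mean that one strand is over at both corners.
\<close>

definition move2 :: "diagram \<Rightarrow> diagram \<Rightarrow> (nat \<Rightarrow> nat) \<Rightarrow> bool" where
  "move2 D D' f \<longleftrightarrow> (\<exists>c c'. bigon D c c' \<and> kind D c = Pos \<and> kind D c' = Neg \<and> erases D {c, c'} D' f)"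

fun over :: "kind \<Rightarrow> dir \<Rightarrow> bool" where
  "over k h \<longleftrightarrow> k = Pos \<and> h = Rightward \<or> k = Neg \<and> h = Leftward"

fun under :: "kind \<Rightarrow> dir \<Rightarrow> bool" where
  "under k h \<longleftrightarrow> k = Pos \<and> h = Leftward \<or> k = Neg \<and> h = Rightward"

text \<open>
  Third move, for a triangular face with sides \<open>m 0\<close>, \<open>m 1\<close>, \<open>m 2\<close>, where \<open>m i\<close> goes from passage
  \<open>p i\<close> to passage \<open>q i\<close>: each of the three strands makes its two passages in the other order.  One
  strand is over, or under, at both of its passages; the crossing of the other two is arbitrary,
  which for a singular crossing gives the moves of a strand over or under a double point.
\<close>

definition move3 :: "diagram \<Rightarrow> diagram \<Rightarrow> (nat \<Rightarrow> nat) \<Rightarrow> bool" where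
  "move3 D D' f \<longleftrightarrow> f = id \<and> (\<exists>(p :: nat \<Rightarrow> nat \<times> dir) (q :: nat \<Rightarrow> nat \<times> dir) m z T.
     T \<subseteq> crossings D \<and> card T = 3 \<and>
     inj_on p {..<3} \<and> inj_on q {..<3} \<and> p ` {..<3} \<inter> q ` {..<3} = {} \<and>
     p ` {..<3} \<union> q ` {..<3} = T \<times> UNIV \<and>
     inj_on m {..<3} \<and> (\<lambda>i. (m i, z i)) ` {..<3} \<in> faces D \<and>
     (\<forall>i<3. fst (p i) \<noteq> fst (q i) \<and> tgt D (p i) = m i \<and> src D (q i) = m i) \<and>
     (\<exists>i<3. over (kind D (fst (p i))) (snd (p i)) \<and> over (kind D (fst (q i))) (snd (q i)) \<or>
            under (kind D (fst (p i))) (snd (p i)) \<and> under (kind D (fst (q i))) (snd (q i))) \<and>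
     arcs D' = arcs D \<and> crossings D' = crossings D \<and> (\<forall>c\<in>crossings D. kind D' c = kind D c) \<and>
     (\<forall>i<3. src D' (p i) = src D (q i) \<and> tgt D' (p i) = tgt D (q i) \<and>
            src D' (q i) = src D (p i) \<and> tgt D' (q i) = tgt D (p i)) \<and>
     (\<forall>c\<in>crossings D - T. \<forall>h. src D' (c, h) = src D (c, h) \<and> tgt D' (c, h) = tgt D (c, h)))"

text \<open>
  Singular twist move: a half turn of the double point carries an adjacent crossing of the same
  two strands from one side of it to the other.  As the underlying graph is unchanged, this
  exchanges the kinds of the two corners of the bigon.
\<close>

definition move_twist :: "diagram \<Rightarrow> diagram \<Rightarrow> (nat \<Rightarrow> nat) \<Rightarrow> bool" where
  "move_twist D D' f \<longleftrightarrow> f = id \<and> (\<exists>c c'. bigon D c c' \<and> kind D c = Sing \<and> kind D c' \<noteq> Sing \<and>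
     D' = set_kind (set_kind D c (kind D c')) c' Sing)"

definition move :: "diagram \<Rightarrow> diagram \<Rightarrow> (nat \<Rightarrow> nat) \<Rightarrow> bool" where
  "move D D' f \<longleftrightarrow> link_diagram D \<and> link_diagram D' \<and>
     (relabels D D' f \<or> move1 D D' f \<or> move2 D D' f \<or> move3 D D' f \<or> move_twist D D' f)"

definition link_isotopic :: "diagram \<Rightarrow> diagram \<Rightarrow> bool" where
  "link_isotopic = equivclp (\<lambda>D D'. \<exists>f. move D D' f)"


text \<open>A component is a set of arcs, so a set partition of the components has type
  \<^typ>\<open>nat set set set\<close>.\<close>

definition cts_diagram :: "diagram \<Rightarrow> nat set set set \<Rightarrow> bool" where
  "cts_diagram D J \<longleftrightarrow> link_diagram D \<and> partition_on (components D) J"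

definition singletons :: "diagram \<Rightarrow> nat set set set" where
  "singletons D = (\<lambda>C. {C}) ` components D"

text \<open>The partition of the components of \<open>D'\<close> induced by \<open>J\<close> along the map \<open>f\<close> of arcs.\<close>

definition carry :: "(nat \<Rightarrow> nat) \<Rightarrow> diagram \<Rightarrow> nat set set set \<Rightarrow> nat set set set" where
  "carry f D' J = (\<lambda>B. {C \<in> components D'. C \<subseteq> f ` \<Union>B}) ` J"

definition cts_isotopic :: "diagram \<times> nat set set set \<Rightarrow> diagram \<times> nat set set set \<Rightarrow> bool" where
  "cts_isotopic = equivclp (\<lambda>(D, J) (D', J').
     cts_diagram D J \<and> cts_diagram D' J' \<and> (\<exists>f. move D D' f \<and> J' = carry f D' J))"

text \<open>The blocks that contain a component through the crossing \<open>c\<close> (one or two) become one block.\<close>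

definition merge :: "diagram \<Rightarrow> nat \<Rightarrow> nat set set set \<Rightarrow> nat set set set" where
  "merge D c J =
     (let M = {B \<in> J. \<exists>C\<in>B. \<exists>h. src D (c, h) \<in> C} in insert (\<Union>M) (J - M))"


text \<open>
  The rules common to the invariants of cts-links; \<open>Q\<close> is the class of diagrams on which the
  invariant is considered (all of them, or the classical ones), and \<open>r\<close> stands for the square root
  of \<open>d\<close>.
\<close>

definition tied_rules ::
  "(diagram \<Rightarrow> bool) \<Rightarrow> 'k::field \<Rightarrow> 'k \<Rightarrow> 'k \<Rightarrow> (diagram \<Rightarrow> nat set set set \<Rightarrow> 'k) \<Rightarrow> bool" where
  "tied_rules Q v a r I \<longleftrightarrow>
     (\<forall>D J D' J'. cts_diagram D J \<and> Q D \<and> cts_isotopic (D, J) (D', J') \<longrightarrow> I D J = I D' J') \<and>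
     (\<forall>D u. arcs D = {u} \<and> crossings D = {} \<longrightarrow> I D {{{u}}} = 1) \<and>
     (\<forall>D J u. cts_diagram D J \<and> Q D \<and> u \<notin> arcs D \<longrightarrow>
        I (add_unknot D u) (insert {{u}} J) = v / (a * r) * I D J) \<and>
     (\<forall>D J c D0 f. cts_diagram D J \<and> c \<in> crossings D \<and> Q (set_kind D c Pos) \<and> smoothing D c D0 f \<longrightarrow>
        1 / r * I (set_kind D c Pos) J - r * I (set_kind D c Neg) J =
        (v - inverse v) * I D0 (carry f D0 (merge D c J)))"

definition F_rules :: "'k::field \<Rightarrow> 'k \<Rightarrow> 'k \<Rightarrow> (diagram \<Rightarrow> nat set set set \<Rightarrow> 'k) \<Rightarrow> bool" where
  "F_rules v a r I \<longleftrightarrow> tied_rules classical v a r I"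

definition Phi_rules ::
  "'k::field \<Rightarrow> 'k \<Rightarrow> 'k \<Rightarrow> 'k \<Rightarrow> 'k \<Rightarrow> (diagram \<Rightarrow> nat set set set \<Rightarrow> 'k) \<Rightarrow> bool" where
  "Phi_rules v a r x y I \<longleftrightarrow> tied_rules (\<lambda>_. True) v a r I \<and>
     (\<forall>D J c D0 f. cts_diagram D J \<and> c \<in> crossings D \<and> smoothing D c D0 f \<longrightarrow>
        I (set_kind D c Sing) J =
        x * I D0 (carry f D0 (merge D c J)) + y * I (set_kind D c Pos) (merge D c J))"

definition Psi_rules ::
  "'k::field \<Rightarrow> 'k \<Rightarrow> 'k \<Rightarrow> 'k \<Rightarrow> 'k \<Rightarrow> (diagram \<Rightarrow> nat set set set \<Rightarrow> 'k) \<Rightarrow> bool" where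
  "Psi_rules v a r x y I \<longleftrightarrow> tied_rules (\<lambda>_. True) v a r I \<and>
     (\<forall>D J c D0 f. cts_diagram D J \<and> c \<in> crossings D \<and> smoothing D c D0 f \<longrightarrow>
        I (set_kind D c Sing) J =
        x * I D0 (carry f D0 (merge D c J)) + y * I (set_kind D c Pos) J)"

definition Homflypt_rules :: "'k::field \<Rightarrow> 'k \<Rightarrow> (diagram \<Rightarrow> 'k) \<Rightarrow> bool" where
  "Homflypt_rules v r P \<longleftrightarrow>
     (\<forall>D D'. link_diagram D \<and> classical D \<and> link_isotopic D D' \<longrightarrow> P D = P D') \<and>
     (\<forall>D u. arcs D = {u} \<and> crossings D = {} \<longrightarrow> P D = 1) \<and>
     (\<forall>D c D0 f. link_diagram D \<and> c \<in> crossings D \<and> classical (set_kind D c Pos) \<and> smoothing D c D0 f \<longrightarrow>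
        1 / r * P (set_kind D c Pos) - r * P (set_kind D c Neg) = (v - inverse v) * P D0)"

definition Paris_Rabenda_rules ::
  "'k::field \<Rightarrow> 'k \<Rightarrow> (diagram \<Rightarrow> 'k) \<Rightarrow> (diagram \<Rightarrow> 'k) \<Rightarrow> bool" where
  "Paris_Rabenda_rules x y P I \<longleftrightarrow>
     (\<forall>D D'. link_diagram D \<and> link_isotopic D D' \<longrightarrow> I D = I D') \<and>
     (\<forall>D. link_diagram D \<and> classical D \<longrightarrow> I D = P D) \<and>
     (\<forall>D c D0 f. link_diagram D \<and> c \<in> crossings D \<and> smoothing D c D0 f \<longrightarrow>
        I (set_kind D c Sing) = x * I D0 + y * I (set_kind D c Pos))"

definition tied_distinguished :: "(diagram \<Rightarrow> nat set set set \<Rightarrow> 'k) \<Rightarrow> diagram \<Rightarrow> diagram \<Rightarrow> bool" where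
  "tied_distinguished I D D' \<longleftrightarrow>
     card (components D) = card (components D') \<and> I D (singletons D) \<noteq> I D' (singletons D')"

definition distinguished :: "(diagram \<Rightarrow> 'k) \<Rightarrow> diagram \<Rightarrow> diagram \<Rightarrow> bool" where
  "distinguished I D D' \<longleftrightarrow> I D \<noteq> I D'"


text \<open>
  In \<open>S\<close> a circle with just two arcs goes through the crossings \<open>c\<close> and \<open>c'\<close>, and a strand enters
  the circle at one of them and leaves it at the other; inside the circle there is only the arc
  of the strand from \<open>c\<close> to \<open>c'\<close>.  One of the two crossings is singular and the other one is
  negative.  Erasing both leaves \<open>D\<close> and a disjoint circle \<open>u\<close>, where the strand is part of the
  component \<open>C\<close> of \<open>D\<close>.  The value of \<open>h\<close> and the order of the two crossings account for the
  orientation of the circle.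
\<close>

definition adds_circle :: "diagram \<Rightarrow> nat set \<Rightarrow> diagram \<Rightarrow> bool" where
  "adds_circle D C S \<longleftrightarrow> link_diagram S \<and> (\<exists>c c' h u f.
     c \<in> crossings S \<and> c' \<in> crossings S \<and> {kind S c, kind S c'} = {Sing, Neg} \<and>
     tgt S (c, h) = src S (c', opp h) \<and> tgt S (c', opp h) = src S (c, h) \<and>
     tgt S (c, opp h) = src S (c', h) \<and>
     u \<notin> arcs D \<and> erases S {c, c'} (add_unknot D u) f \<and>
     f (tgt S (c, h)) = u \<and> f (tgt S (c, opp h)) \<in> C)"

text \<open>
  The same for links, that is, up to isotopy on both sides; the component is arbitrary.
\<close>

definition obtained_by_adding_circle :: "diagram \<Rightarrow> diagram \<Rightarrow> bool" where
  "obtained_by_adding_circle L S \<longleftrightarrow> (\<exists>D C S'.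
     link_isotopic L D \<and> C \<in> components D \<and> adds_circle D C S' \<and> link_isotopic S' S)"


text \<open>
  The field of rational functions over the complex numbers in \<open>v\<close>, \<open>a\<close>, \<open>b\<close>, \<open>x\<close>, \<open>y\<close>, as the
  fraction field of the iterated polynomial ring with \<open>v\<close> innermost and \<open>y\<close> outermost.
\<close>

type_synonym ratfun = "complex poly poly poly poly poly fract"

definition var_v :: ratfun where "var_v = to_fract [:[:[:[:[:0, 1:]:]:]:]:]"
definition var_a :: ratfun where "var_a = to_fract [:[:[:[:0, 1:]:]:]:]"
definition var_b :: ratfun where "var_b = to_fract [:[:[:0, 1:]:]:]"
definition var_x :: ratfun where "var_x = to_fract [:[:0, 1:]:]"
definition var_y :: ratfun where "var_y = to_fract [:0, 1:]"

definition field_hom :: "('f::field \<Rightarrow> 'k::field) \<Rightarrow> bool" where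
  "field_hom \<phi> \<longleftrightarrow> \<phi> 1 = 1 \<and> (\<forall>s t. \<phi> (s + t) = \<phi> s + \<phi> t) \<and> (\<forall>s t. \<phi> (s * t) = \<phi> s * \<phi> t)"

end

theory Submission
  imports Defs
begin

text \<open>
  Resolving the singular crossing of a singular link \<open>S\<close> obtained from \<open>L\<close> gives \<open>L\<close> with a kink
  and, by a second Reidemeister move, the split union of \<open>L\<close> and a circle.  For \<open>\<Psi>\<close> the circle is a
  block of its own and contributes \<open>v / (a r)\<close>.  For \<open>\<Phi>\<close> it is tied to the component, and for the
  Homflypt polynomial there are no ties; in both cases rule III' at the kink, whose two signs both
  give \<open>L\<close> back, shows that the circle contributes \<open>(r\<inverse> - r) / (v - v\<inverse>) = v b / (a r)\<close>.  Hence each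
  invariant of \<open>S\<close> is that of \<open>L\<close>, with singleton blocks in the tied case, times a factor
  \<open>x + y v t / (a r)\<close> that does not depend on \<open>L\<close>.  The factor is nonzero because
  \<open>x\<^sup>2 a (a + (1 - v\<^sup>2) b) \<noteq> y\<^sup>2 v\<^sup>2 t\<^sup>2\<close> for \<open>t = b\<close> and \<open>t = 1\<close>.
\<close>

subsection \<open>Classes of a symmetric closure\<close>

text \<open>The rules speak of \<open>link_diagram\<close>s only, so every diagram met on the way
  has to satisfy Euler's formula. The positive resolution inherits it from \<open>S\<close>, with
  which it shares the underlying graph. The obstacle is the smoothing \<open>K\<close>. Instead of
  following the faces of \<open>S\<close> through the smoothing, the proof counts from the other
  end: straightening the kink of \<open>K\<close> gives \<open>D\<close>, and a kink accounts for
  exactly one crossing and one face. For this the conditions of \<open>link_diagram\<close> other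
  than Euler's formula are kept apart as \<open>arc_graph\<close>. Components, pieces and faces are
  all classes of a generated equivalence relation, so one lemma on quotient maps,
  \<open>classes_bij\<close>, serves for all three. Either crossing may be the singular one, and the
  circle may have either orientation; the direction \<open>h\<close> and the names \<open>s\<close>,
  \<open>n\<close> beside \<open>c\<close>, \<open>c'\<close> absorb these cases.\<close>

definition conn :: "('a \<times> 'a) set \<Rightarrow> ('a \<times> 'a) set" where
  "conn r = (r \<union> r\<inverse>)\<^sup>*"

lemma conn_refl [simp]: "(a, a) \<in> conn r"
  by (simp add: conn_def)

lemma conn_base: "(a, b) \<in> r \<Longrightarrow> (a, b) \<in> conn r"
  by (auto simp: conn_def)

lemma conn_trans: "(a, b) \<in> conn r \<Longrightarrow> (b, c) \<in> conn r \<Longrightarrow> (a, c) \<in> conn r"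
  by (auto simp: conn_def)

lemma conn_sym: "(a, b) \<in> conn r \<Longrightarrow> (b, a) \<in> conn r"
  unfolding conn_def
  by (metis converse_Un converse_converse rtrancl_converseI sup_commute)

lemma conn_map:
  assumes "(a, b) \<in> conn r" and "\<And>x y. (x, y) \<in> r \<Longrightarrow> (f x, f y) \<in> conn s"
  shows "(f a, f b) \<in> conn s"
  using assms(1) unfolding conn_def[of r]
proof (induction rule: rtrancl_induct)
  case (step y z)
  then have "(f y, f z) \<in> conn s"
    using assms(2) conn_sym by fastforce
  with step.IH show ?case by (rule conn_trans)
qed simp

text \<open>Bounds a class from above: with \<open>k\<close> the membership in a candidate class, or
  a choice of representatives, it shows which elements cannot be related.\<close>

lemma conn_invariant:
  assumes "(a, b) \<in> conn r" and "\<And>x y. (x, y) \<in> r \<Longrightarrow> k x = k y"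
  shows "k a = k b"
  using assms(1) unfolding conn_def
  by (induction rule: rtrancl_induct) (auto simp: assms(2))

lemma conn_subset: "r \<subseteq> conn s \<Longrightarrow> conn r \<subseteq> conn s"
  using conn_map[where f = "\<lambda>x. x"] by fastforce

text \<open>Such a pair arises at a kink, whose inner sector has the same side of the loop on both
  flanks.\<close>

lemma conn_insert_refl [simp]: "conn (insert (a, a) r) = conn r"
  by (intro equalityI conn_subset) (auto intro: conn_base)

lemma conn_closed: "(a, b) \<in> conn r \<Longrightarrow> r \<subseteq> A \<times> A \<Longrightarrow> a \<in> A \<longleftrightarrow> b \<in> A"
  by (rule conn_invariant[where k = "\<lambda>x. x \<in> A"]) auto

lemma conn_right: "(b, c) \<in> conn r \<Longrightarrow> (a, b) \<in> conn r \<longleftrightarrow> (a, c) \<in> conn r"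
  by (blast intro: conn_trans conn_sym)

lemma equiv_conn: "equiv UNIV (conn r)"
  by (auto intro!: equivI refl_onI symI transI intro: conn_sym conn_trans)

lemma class_eq_iff: "conn r `` {a} = conn r `` {b} \<longleftrightarrow> (a, b) \<in> conn r"
  using equiv_conn[of r] by (simp add: eq_equiv_class_iff)

lemma classes_eq: "classes A r = (\<lambda>a. conn r `` {a}) ` A"
  by (auto simp: classes_def conn_def quotient_def)

lemma in_class: "X \<in> classes A r \<Longrightarrow> a \<in> X \<Longrightarrow> X = conn r `` {a}"
  by (auto simp: classes_eq intro: conn_trans conn_sym)

lemma classes_disjoint: "X \<in> classes A r \<Longrightarrow> Y \<in> classes A r \<Longrightarrow> a \<in> X \<Longrightarrow> a \<in> Y \<Longrightarrow> X = Y"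
  by (metis in_class)

lemma classes_nonempty: "X \<in> classes A r \<Longrightarrow> X \<noteq> {}"
  by (auto simp: classes_eq Image_singleton intro: conn_refl)

lemma class_in_classes: "a \<in> A \<Longrightarrow> conn r `` {a} \<in> classes A r"
  by (auto simp: classes_eq)

lemma classes_subset: "r \<subseteq> A \<times> A \<Longrightarrow> X \<in> classes A r \<Longrightarrow> X \<subseteq> A"
  by (auto simp: classes_eq dest: conn_closed)

lemma finite_classes: "finite A \<Longrightarrow> finite (classes A r)"
  by (simp add: classes_eq)

text \<open>Here \<open>f\<close> acts as a quotient map: \<open>mono\<close> and
  \<open>lift\<close> match the two relations, and by \<open>fib\<close> it identifies only elements
  that are already related. Hence it neither fuses classes nor splits them.\<close>

lemma classes_bij:
  assumes img: "f ` A = B" and r: "r \<subseteq> A \<times> A"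
    and mono: "\<And>a b. (a, b) \<in> r \<Longrightarrow> (f a, f b) \<in> conn s"
    and lift: "\<And>u v. (u, v) \<in> s \<Longrightarrow> \<exists>a\<in>A. \<exists>b\<in>A. f a = u \<and> f b = v \<and> (a, b) \<in> conn r"
    and fib: "\<And>a b. a \<in> A \<Longrightarrow> b \<in> A \<Longrightarrow> f a = f b \<Longrightarrow> (a, b) \<in> conn r"
  shows "bij_betw ((`) f) (classes A r) (classes B s)"
proof -
  \<comment> \<open>A section of \<open>f\<close> carries chains of \<open>s\<close> back to chains
    of \<open>r\<close>, up to an ambiguity inside the fibres that \<open>fib\<close>
    controls.\<close>
  define g where "g = inv_into A f"
  have g: "g u \<in> A" "f (g u) = u" if "u \<in> B" for u
    using that img by (auto simp: g_def inv_into_into f_inv_into_f)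
  have s: "s \<subseteq> B \<times> B"
    using lift img by fastforce
  have refl: "(a, b) \<in> conn r" if "a \<in> A" "b \<in> A" "(f a, f b) \<in> conn s" for a b
  proof -
    have "(g (f a), g (f b)) \<in> conn r"
    proof (rule conn_map[OF that(3)])
      fix u v assume uv: "(u, v) \<in> s"
      then obtain a' b' where "a' \<in> A" "b' \<in> A" "f a' = u" "f b' = v" "(a', b') \<in> conn r"
        using lift by blast
      moreover have "u \<in> B" "v \<in> B" using uv s by auto
      ultimately have "(g u, a') \<in> conn r" "(a', b') \<in> conn r" "(b', g v) \<in> conn r"
        by (auto intro!: fib simp: g)
      then show "(g u, g v) \<in> conn r" by (blast intro: conn_trans)
    qed
    moreover have "f a \<in> B" "f b \<in> B" using that img by auto
    then have "(a, g (f a)) \<in> conn r" "(g (f b), b) \<in> conn r"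
      using that by (auto intro!: fib simp: g)
    ultimately show ?thesis by (blast intro: conn_trans)
  qed
  have cl: "f ` (conn r `` {a}) = conn s `` {f a}" if "a \<in> A" for a
  proof
    show "f ` (conn r `` {a}) \<subseteq> conn s `` {f a}"
      using conn_map[of _ _ r f s] mono by auto
    show "conn s `` {f a} \<subseteq> f ` (conn r `` {a})"
    proof
      fix v assume "v \<in> conn s `` {f a}"
      then have v: "(f a, v) \<in> conn s" by simp
      then have "v \<in> B" using conn_closed[OF v s] that img by auto
      then obtain b where b: "b \<in> A" "v = f b" using img by auto
      with v refl[OF that] show "v \<in> f ` (conn r `` {a})" by auto
    qed
  qed
  show ?thesis
    unfolding bij_betw_def
  proof
    show "inj_on ((`) f) (classes A r)"
      by (auto simp: inj_on_def classes_eq cl class_eq_iff refl)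
    show "(`) f ` classes A r = classes B s"
      using img by (force simp: classes_eq cl image_image)
  qed
qed

text \<open>The relation does not reach \<open>x\<close>, which therefore forms a class of its own.
  This is how a circle without crossings and the face inside a kink are counted.\<close>

lemma classes_insert_isolated:
  assumes "x \<notin> A" "r \<subseteq> A \<times> A"
  shows "classes (insert x A) r = insert {x} (classes A r)" "{x} \<notin> classes A r"
proof -
  have "y = x" if "(x, y) \<in> conn r" for y
    using conn_invariant[OF that, of "\<lambda>y. y = x"] assms by auto
  then have "conn r `` {x} = {x}" by auto
  then show "classes (insert x A) r = insert {x} (classes A r)"
    by (simp add: classes_eq)
  show "{x} \<notin> classes A r"
    using classes_subset[OF assms(2)] assms(1) by blast
qed

lemma card_classes_insert_isolated:
  assumes "x \<notin> A" "r \<subseteq> A \<times> A" "finite A"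
  shows "card (classes (insert x A) r) = Suc (card (classes A r))"
  using classes_insert_isolated[OF assms(1,2)] finite_classes[OF assms(3)] by simp

text \<open>The union of the two classes is closed under the enlarged relation, and nothing changes
  outside it; the two classes may coincide. On the level of arcs this mirrors the effect of
  \<open>merge\<close> on singleton blocks.\<close>

lemma classes_insert_pair:
  assumes "a \<in> A" "b \<in> A" "r \<subseteq> A \<times> A"
  shows "classes A (insert (a, b) r) =
    insert (conn r `` {a} \<union> conn r `` {b}) (classes A r - {conn r `` {a}, conn r `` {b}})"
proof -
  let ?U = "conn r `` {a} \<union> conn r `` {b}"
  let ?s = "insert (a, b) r"
  have sub: "conn r \<subseteq> conn ?s" by (rule conn_subset) (auto intro: conn_base)
  have inv: "x \<in> ?U \<longleftrightarrow> y \<in> ?U" if "(x, y) \<in> conn ?s" for x y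
  proof (rule conn_invariant[OF that, where k = "\<lambda>x. x \<in> ?U"])
    fix y z assume "(y, z) \<in> ?s"
    then consider "y = a \<and> z = b" | "(y, z) \<in> r" by auto
    then show "y \<in> ?U \<longleftrightarrow> z \<in> ?U"
      by cases (simp_all add: conn_right[OF conn_base])
  qed
  have ab: "(a, b) \<in> conn ?s" by (rule conn_base) simp
  have U: "conn ?s `` {x} = ?U" if "x \<in> ?U" for x
  proof (intro equalityI subsetI)
    fix y assume "y \<in> ?U"
    then have "(a, y) \<in> conn ?s" "(a, x) \<in> conn ?s"
      using that sub conn_trans[OF ab] by auto
    then show "y \<in> conn ?s `` {x}" by (auto intro: conn_trans conn_sym)
  qed (use inv that in auto)
  have notU: "conn ?s `` {x} = conn r `` {x}" if "x \<notin> ?U" for x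
  proof (intro equalityI subsetI)
    fix y assume "y \<in> conn ?s `` {x}"
    then have "(x, y) \<in> conn ?s" by simp
    then have "(x, x) \<in> conn r \<longleftrightarrow> (x, y) \<in> conn r"
    proof (rule conn_invariant[where k = "\<lambda>y. (x, y) \<in> conn r"])
      fix y z assume "(y, z) \<in> ?s"
      then consider "y = a \<and> z = b" | "(y, z) \<in> r" by auto
      moreover have "(x, a) \<notin> conn r" "(x, b) \<notin> conn r"
        using that conn_sym[of x a] conn_sym[of x b] by auto
      ultimately show "(x, y) \<in> conn r \<longleftrightarrow> (x, z) \<in> conn r"
        by cases (simp_all add: conn_right[OF conn_base])
    qed
    then show "y \<in> conn r `` {x}" by simp
  qed (use sub in auto)
  show ?thesis (is "?L = ?R")
  proof (intro equalityI subsetI)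
    fix X assume "X \<in> ?L"
    then obtain x where x: "x \<in> A" "X = conn ?s `` {x}" by (auto simp: classes_eq)
    show "X \<in> ?R"
    proof (cases "x \<in> ?U")
      case False
      then have "conn r `` {x} \<noteq> conn r `` {a}" "conn r `` {x} \<noteq> conn r `` {b}"
        by (auto simp: class_eq_iff intro: conn_sym)
      with x False notU[OF False] show ?thesis by (auto simp: classes_eq)
    qed (use U x in simp)
  next
    fix X assume X: "X \<in> ?R"
    show "X \<in> ?L"
    proof (cases "X = ?U")
      case True
      then show ?thesis using U[of a] assms by (force simp: classes_eq)
    next
      case False
      with X obtain x where x: "x \<in> A" "X = conn r `` {x}" "X \<noteq> conn r `` {a}" "X \<noteq> conn r `` {b}"
        by (auto simp: classes_eq)
      then have "x \<notin> ?U" by (auto simp: class_eq_iff intro: conn_sym)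
      from notU[OF this] x show ?thesis by (auto simp: classes_eq)
    qed
  qed
qed

subsection \<open>Components\<close>

definition strands :: "diagram \<Rightarrow> (nat \<times> nat) set" where
  "strands D = {(src D (c, h), tgt D (c, h)) | c h. c \<in> crossings D}"

lemma components_eq: "components D = classes (arcs D) (strands D)"
  by (simp add: components_def strands_def)

lemma opp_simps [simp]: "opp (opp h) = h" "opp h \<noteq> h" "h \<noteq> opp h" "opp h = opp h' \<longleftrightarrow> h = h'"
  by (cases h; cases h'; simp)+

lemma dir_eq_opp: "h' = h \<or> h' = opp h"
  by (cases h; cases h'; simp)

lemma UNIV_dir: "UNIV = {h, opp h}"
  using dir_eq_opp by auto

definition arc_graph :: "diagram \<Rightarrow> bool" where
  "arc_graph D \<longleftrightarrow>
     finite (arcs D) \<and> arcs D \<noteq> {} \<and> finite (crossings D) \<and>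
     inj_on (src D) (crossings D \<times> UNIV) \<and> inj_on (tgt D) (crossings D \<times> UNIV) \<and>
     src D ` (crossings D \<times> UNIV) = tgt D ` (crossings D \<times> UNIV) \<and>
     src D ` (crossings D \<times> UNIV) \<subseteq> arcs D"

lemma link_diagram_iff:
  "link_diagram D \<longleftrightarrow>
     arc_graph D \<and> card (faces D) = card (crossings D) + 2 * card (pieces D)"
  by (auto simp: link_diagram_def arc_graph_def)

lemma arc_graph_if_link_diagram: "link_diagram D \<Longrightarrow> arc_graph D"
  by (simp add: link_diagram_iff)

context
  fixes D
  assumes D: "arc_graph D"
begin

lemma src_in_arcs: "c \<in> crossings D \<Longrightarrow> src D (c, h) \<in> arcs D"
  using D unfolding arc_graph_def by blast

lemma tgt_in_arcs: "c \<in> crossings D \<Longrightarrow> tgt D (c, h) \<in> arcs D"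
  using D unfolding arc_graph_def by blast

lemma src_eq_iff:
  "c \<in> crossings D \<Longrightarrow> c' \<in> crossings D \<Longrightarrow> src D (c, h) = src D (c', h') \<longleftrightarrow> c = c' \<and> h = h'"
  using D unfolding arc_graph_def by (auto dest: inj_onD)

lemma tgt_eq_iff:
  "c \<in> crossings D \<Longrightarrow> c' \<in> crossings D \<Longrightarrow> tgt D (c, h) = tgt D (c', h') \<longleftrightarrow> c = c' \<and> h = h'"
  using D unfolding arc_graph_def by (auto dest: inj_onD)

lemma strands_subset: "strands D \<subseteq> arcs D \<times> arcs D"
  by (auto simp: strands_def src_in_arcs tgt_in_arcs)

lemma finite_components: "finite (components D)"
  using D by (simp add: components_eq finite_classes arc_graph_def)

lemma component_subset: "C \<in> components D \<Longrightarrow> C \<subseteq> arcs D"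
  unfolding components_eq by (rule classes_subset[OF strands_subset])

end

lemma components_disjoint:
  "C \<in> components D \<Longrightarrow> C' \<in> components D \<Longrightarrow> e \<in> C \<Longrightarrow> e \<in> C' \<Longrightarrow> C = C'"
  unfolding components_eq by (rule classes_disjoint)

lemma component_nonempty: "C \<in> components D \<Longrightarrow> C \<noteq> {}"
  unfolding components_eq by (rule classes_nonempty)

text \<open>\<open>carry\<close> is defined by inclusion. Components are nonempty and disjoint, so a
  component inside a union of images of components is one of these images, and the inclusion test
  reduces to an elementwise image.\<close>

lemma carry_bij:
  assumes "bij_betw ((`) f) (components D) (components D')" and "\<Union>J \<subseteq> components D"
  shows "carry f D' J = (`) ((`) f) ` J"
  unfolding carry_def
proof (rule image_cong[OF refl])
  fix B assume "B \<in> J"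
  then have B: "f ` C \<in> components D'" if "C \<in> B" for C
    using that assms bij_betwE by blast
  show "{C \<in> components D'. C \<subseteq> f ` \<Union> B} = (`) f ` B"
  proof (intro equalityI subsetI)
    fix C assume C: "C \<in> {C \<in> components D'. C \<subseteq> f ` \<Union> B}"
    then obtain e X where "X \<in> B" "e \<in> f ` X" "e \<in> C"
      using component_nonempty by fastforce
    then show "C \<in> (`) f ` B"
      using C B components_disjoint by blast
  qed (use B in auto)
qed

lemma Union_singletons [simp]: "\<Union>(singletons D) = components D"
  by (auto simp: singletons_def)

lemma carry_singletons:
  assumes "bij_betw ((`) f) (components D) (components D')"
  shows "carry f D' (singletons D) = singletons D'"
proof -
  have "carry f D' (singletons D) = (`) ((`) f) ` singletons D"
    by (rule carry_bij[OF assms]) simp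
  also have "\<dots> = (\<lambda>C. {C}) ` ((`) f ` components D)"
    by (simp add: singletons_def image_image)
  finally show ?thesis
    using assms by (simp add: bij_betw_imp_surj_on singletons_def)
qed

lemma partition_on_image:
  assumes "bij_betw g A B" "partition_on A J"
  shows "partition_on B ((`) g ` J)"
proof -
  have "{} \<notin> J" and g: "inj_on g A" "g ` A = B"
    using assms by (auto simp: partition_on_def bij_betw_def)
  then have "(`) g ` J - {{}} = (`) g ` J" by auto
  with partition_on_inj_image[OF assms(2) g(1)] g(2) show ?thesis by simp
qed

lemma partition_singletons: "partition_on (components D) (singletons D)"
  by (auto simp: singletons_def partition_on_def disjoint_def)

lemma cts_diagram_singletons [simp]: "cts_diagram D (singletons D) \<longleftrightarrow> link_diagram D"
  by (simp add: cts_diagram_def partition_singletons)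

subsection \<open>Moves\<close>

lemma resolvesD:
  assumes "resolves D S G D' f"
  shows "f ` arcs D = arcs D'" "crossings D' = crossings D - S"
    "c \<in> crossings D' \<Longrightarrow> kind D' c = kind D c"
    "c \<in> crossings D' \<Longrightarrow> src D' (c, h) = f (src D (c, h))"
    "c \<in> crossings D' \<Longrightarrow> tgt D' (c, h) = f (tgt D (c, h))"
    "e \<in> arcs D \<Longrightarrow> e' \<in> arcs D \<Longrightarrow> f e = f e' \<longleftrightarrow> (e, e') \<in> conn G"
  using assms unfolding resolves_def conn_def by blast+

text \<open>Erasing glues only arcs that follow each other on one strand, so components neither fuse
  nor split. This covers the first two moves.\<close>

lemma erases_components:
  assumes "arc_graph D" and "S \<subseteq> crossings D" and "erases D S D' f"
  shows "bij_betw ((`) f) (components D) (components D')"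
  unfolding components_eq
proof (rule classes_bij)
  note E = resolvesD[OF assms(3)[unfolded erases_def]]
  let ?G = "{(src D (c, h), tgt D (c, h)) | c h. c \<in> S}"
  show "f ` arcs D = arcs D'" by (rule E)
  show "strands D \<subseteq> arcs D \<times> arcs D" by (rule strands_subset[OF assms(1)])
  show "(f a, f b) \<in> conn (strands D')" if "(a, b) \<in> strands D" for a b
  proof -
    from that obtain c h where c: "a = src D (c, h)" "b = tgt D (c, h)" "c \<in> crossings D"
      by (auto simp: strands_def)
    show ?thesis
    proof (cases "c \<in> S")
      case True
      then have "(a, b) \<in> conn ?G" using c by (auto intro!: conn_base)
      then have "f a = f b"
        using E(6)[of a b] c src_in_arcs[OF assms(1)] tgt_in_arcs[OF assms(1)] by simp
      then show ?thesis by simp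
    next
      case False
      with c have "c \<in> crossings D'" by (simp add: E(2))
      with c show ?thesis by (auto simp: strands_def E(4,5)[symmetric] intro!: conn_base)
    qed
  qed
  show "\<exists>a\<in>arcs D. \<exists>b\<in>arcs D. f a = w \<and> f b = z \<and> (a, b) \<in> conn (strands D)"
    if "(w, z) \<in> strands D'" for w z
  proof -
    from that obtain c h where c: "w = src D' (c, h)" "z = tgt D' (c, h)" "c \<in> crossings D'"
      by (auto simp: strands_def)
    moreover have "(src D (c, h), tgt D (c, h)) \<in> strands D"
      using c by (auto simp: strands_def E(2))
    ultimately show ?thesis
      using strands_subset[OF assms(1)] conn_base[of _ _ "strands D"] E(4,5)
      by (metis (no_types) SigmaD1 SigmaD2 subsetD)
  qed
  have "conn ?G \<subseteq> conn (strands D)"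
    using assms(2) by (intro conn_subset) (auto simp: strands_def intro!: conn_base)
  then show "(a, b) \<in> conn (strands D)" if "a \<in> arcs D" "b \<in> arcs D" "f a = f b" for a b
    using that E(6) by blast
qed

lemma relabels_components:
  assumes "arc_graph D" and "relabels D D' f"
  shows "bij_betw ((`) f) (components D) (components D')"
proof -
  from assms(2) obtain g where f: "bij_betw f (arcs D) (arcs D')"
    and g: "bij_betw g (crossings D) (crossings D')"
    and st: "\<And>c h. c \<in> crossings D \<Longrightarrow> src D' (g c, h) = f (src D (c, h))"
      "\<And>c h. c \<in> crossings D \<Longrightarrow> tgt D' (g c, h) = f (tgt D (c, h))"
    unfolding relabels_def by blast
  show ?thesis
    unfolding components_eq
  proof (rule classes_bij)
    show "f ` arcs D = arcs D'" using f by (rule bij_betw_imp_surj_on)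
    show "strands D \<subseteq> arcs D \<times> arcs D" by (rule strands_subset[OF assms(1)])
    show "(f a, f b) \<in> conn (strands D')" if "(a, b) \<in> strands D" for a b
    proof -
      from that obtain c h where c: "a = src D (c, h)" "b = tgt D (c, h)" "c \<in> crossings D"
        by (auto simp: strands_def)
      then have "g c \<in> crossings D'" using g bij_betwE by blast
      then have "(src D' (g c, h), tgt D' (g c, h)) \<in> conn (strands D')"
        by (auto simp: strands_def intro!: conn_base)
      with c show ?thesis by (simp add: st)
    qed
    show "\<exists>a\<in>arcs D. \<exists>b\<in>arcs D. f a = w \<and> f b = z \<and> (a, b) \<in> conn (strands D)"
      if "(w, z) \<in> strands D'" for w z
    proof -
      from that obtain c' h where "w = src D' (c', h)" "z = tgt D' (c', h)" "c' \<in> crossings D'"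
        by (auto simp: strands_def)
      moreover from this obtain c where c: "c \<in> crossings D" "c' = g c"
        using g bij_betw_imp_surj_on by blast
      moreover have "(src D (c, h), tgt D (c, h)) \<in> strands D"
        using c by (auto simp: strands_def)
      ultimately show ?thesis
        using strands_subset[OF assms(1)] conn_base[of _ _ "strands D"] st
        by (metis (no_types) SigmaD1 SigmaD2 subsetD)
    qed
    show "(a, b) \<in> conn (strands D)" if "a \<in> arcs D" "b \<in> arcs D" "f a = f b" for a b
      using that f by (auto simp: bij_betw_def inj_on_def)
  qed
qed

lemma relabels_classical:
  assumes "relabels D D' f"
  shows "classical D \<longleftrightarrow> classical D'"
proof -
  from assms obtain g where "bij_betw g (crossings D) (crossings D')"
    and "\<And>c. c \<in> crossings D \<Longrightarrow> kind D' (g c) = kind D c"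
    unfolding relabels_def by blast
  then show ?thesis
    unfolding classical_def bij_betw_def by (metis (no_types, lifting) image_iff)
qed

lemma erases_classical:
  assumes "erases D S D' f" and "\<And>c. c \<in> S \<Longrightarrow> kind D c \<noteq> Sing"
  shows "classical D \<longleftrightarrow> classical D'"
  using resolvesD(2,3)[OF assms(1)[unfolded erases_def]] assms(2) unfolding classical_def by auto

lemma strands_set_kind [simp]: "strands (set_kind D c k) = strands D"
  by (simp add: strands_def set_kind_def)

lemma set_kind_simps [simp]:
  "arcs (set_kind D c k) = arcs D" "crossings (set_kind D c k) = crossings D"
  "src (set_kind D c k) = src D" "tgt (set_kind D c k) = tgt D"
  "kind (set_kind D c k) = (kind D)(c := k)"
  by (simp_all add: set_kind_def)

lemma components_set_kind [simp]: "components (set_kind D c k) = components D"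
  by (simp add: components_eq)

lemma singletons_set_kind [simp]: "singletons (set_kind D c k) = singletons D"
  by (simp add: singletons_def)

lemma link_diagram_set_kind [simp]: "link_diagram (set_kind D c k) \<longleftrightarrow> link_diagram D"
  by (simp add: link_diagram_def faces_def corners_def pieces_def)

lemma cts_diagram_set_kind [simp]: "cts_diagram (set_kind D c k) J \<longleftrightarrow> cts_diagram D J"
  by (simp add: cts_diagram_def)

lemma faces_set_kind [simp]: "faces (set_kind D c k) = faces D"
  by (simp add: faces_def corners_def)

text \<open>A strand of the triangle still leads from \<open>src D (p i)\<close> over \<open>m i\<close> to \<open>tgt D (q i)\<close>; only the
  order of its two passages is exchanged.\<close>

lemma move3_strands:
  assumes "move3 D D' f"
  shows "strands D' = strands D" "arcs D' = arcs D" "f = id" "classical D' \<longleftrightarrow> classical D"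
proof -
  from assms obtain p q :: "nat \<Rightarrow> nat \<times> dir" and T where
    T: "T \<subseteq> crossings D" "p ` {..<3} \<union> q ` {..<3} = T \<times> UNIV"
    and cr: "crossings D' = crossings D" "\<forall>c\<in>crossings D. kind D' c = kind D c"
    and sw: "\<forall>i<3. src D' (p i) = src D (q i) \<and> tgt D' (p i) = tgt D (q i) \<and>
            src D' (q i) = src D (p i) \<and> tgt D' (q i) = tgt D (p i)"
    and rest: "\<forall>c\<in>crossings D - T. \<forall>h. src D' (c, h) = src D (c, h) \<and> tgt D' (c, h) = tgt D (c, h)"
    unfolding move3_def by - (elim conjE exE, rule that, assumption+)
  let ?P = "\<lambda>D. (\<lambda>p. (src D p, tgt D p))"
  have st: "strands E = ?P E ` (T \<times> UNIV) \<union> ?P E ` ((crossings D - T) \<times> UNIV)"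
    if "crossings E = crossings D" for E
    using that T(1) by (auto simp: strands_def)
  have "?P D' (p i) = ?P D (q i)" "?P D' (q i) = ?P D (p i)" if "i < 3" for i
    using sw that by simp_all
  then have "?P D' ` (T \<times> UNIV) = ?P D ` (T \<times> UNIV)"
    unfolding T(2)[symmetric] image_Un image_image
    by (subst Un_commute) (intro arg_cong2[where f = "(\<union>)"] image_cong; simp)
  moreover have "?P D' ` ((crossings D - T) \<times> UNIV) = ?P D ` ((crossings D - T) \<times> UNIV)"
    by (intro image_cong) (auto simp: rest)
  ultimately show "strands D' = strands D"
    using st[of D] st[of D'] cr by simp
  show "arcs D' = arcs D" "f = id" using assms unfolding move3_def by blast+
  show "classical D' \<longleftrightarrow> classical D" by (simp add: classical_def cr)
qed

lemma move_components:
  assumes "move D D' f"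
  shows "bij_betw ((`) f) (components D) (components D')"
proof -
  have D: "arc_graph D" using assms by (simp add: move_def arc_graph_if_link_diagram)
  have id: "bij_betw ((`) id) (components D) (components D)"
    by (simp add: bij_betw_def inj_on_def)
  from assms consider "relabels D D' f" | "move1 D D' f" | "move2 D D' f" | "move3 D D' f"
    | "move_twist D D' f" by (auto simp: move_def)
  then show ?thesis
  proof cases
    case 1
    then show ?thesis by (rule relabels_components[OF D])
  next
    case 2
    then obtain c where "{c} \<subseteq> crossings D" "erases D {c} D' f" by (auto simp: move1_def)
    then show ?thesis by (rule erases_components[OF D])
  next
    case 3
    then obtain c c' where "{c, c'} \<subseteq> crossings D" "erases D {c, c'} D' f"
      by (auto simp: move2_def bigon_def)
    then show ?thesis by (rule erases_components[OF D])
  next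
    case 4
    note move3_strands[OF this]
    with id show ?thesis by (simp add: components_eq)
  next
    case 5
    with id show ?thesis by (auto simp: move_twist_def)
  qed
qed

text \<open>The first two moves remove nonsingular crossings only, and the twist, which alone
  exchanges kinds, has a singular crossing before and after.\<close>

lemma move_classical:
  assumes "move D D' f"
  shows "classical D \<longleftrightarrow> classical D'"
proof -
  from assms consider "relabels D D' f" | "move1 D D' f" | "move2 D D' f" | "move3 D D' f"
    | "move_twist D D' f" by (auto simp: move_def)
  then show ?thesis
  proof cases
    case 1
    then show ?thesis by (rule relabels_classical)
  next
    case 2
    then obtain c where "kind D c \<noteq> Sing" "erases D {c} D' f" by (auto simp: move1_def)
    then show ?thesis by (intro erases_classical) auto
  next
    case 3
    then obtain c c' where "kind D c = Pos" "kind D c' = Neg" "erases D {c, c'} D' f"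
      by (auto simp: move2_def bigon_def)
    then show ?thesis by (intro erases_classical) auto
  next
    case 4
    then show ?thesis by (simp add: move3_strands)
  next
    case 5
    then show ?thesis by (force simp: move_twist_def bigon_def classical_def)
  qed
qed

lemma cts_isotopic_if_move:
  assumes "move D D' f" "cts_diagram D J"
  shows "cts_isotopic (D, J) (D', (`) ((`) f) ` J)"
proof -
  note bij = move_components[OF assms(1)]
  have J: "partition_on (components D) J" using assms(2) by (simp add: cts_diagram_def)
  then have "carry f D' J = (`) ((`) f) ` J"
    by (intro carry_bij[OF bij]) (simp add: partition_on_def)
  moreover have "cts_diagram D' ((`) ((`) f) ` J)"
    using assms(1) partition_on_image[OF bij J] by (simp add: cts_diagram_def move_def)
  ultimately show ?thesis
    unfolding cts_isotopic_def using assms by (intro r_into_equivclp) auto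
qed

lemma cts_isotopic_singletons_if_move:
  assumes "move D D' f"
  shows "cts_isotopic (D, singletons D) (D', singletons D')"
proof -
  have "link_diagram D" using assms by (simp add: move_def)
  with cts_isotopic_if_move[OF assms, of "singletons D"] show ?thesis
    using carry_bij[OF move_components[OF assms], of "singletons D"]
      carry_singletons[OF move_components[OF assms]] by simp
qed

lemma cts_isotopic_sym: "cts_isotopic p q \<Longrightarrow> cts_isotopic q p"
  unfolding cts_isotopic_def by (rule equivclp_sym)

lemma cts_isotopic_trans: "cts_isotopic p q \<Longrightarrow> cts_isotopic q t \<Longrightarrow> cts_isotopic p t"
  unfolding cts_isotopic_def by (rule equivclp_trans)

lemma link_isotopic_if_move: "move D D' f \<Longrightarrow> link_isotopic D D'"
  unfolding link_isotopic_def by (intro r_into_equivclp) blast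

text \<open>Each move matches the components bijectively and so carries singleton blocks to
  singleton blocks; the closure uses moves in both directions. This reduces
  \<open>obtained_by_adding_circle\<close>, which is stated up to isotopy, to one concrete
  diagram.\<close>

lemma link_isotopic_invariants:
  assumes "link_isotopic L D" and "link_diagram L"
  shows "link_diagram D" "card (components L) = card (components D)"
    "classical L \<longleftrightarrow> classical D" "cts_isotopic (L, singletons L) (D, singletons D)"
proof -
  have "link_diagram D \<and> card (components L) = card (components D) \<and>
    (classical L \<longleftrightarrow> classical D) \<and> cts_isotopic (L, singletons L) (D, singletons D)"
    using assms(1) unfolding link_isotopic_def
  proof (induction rule: equivclp_induct)
    case base
    show ?case using assms(2) by (simp add: cts_isotopic_def)
  next
    case (step D E)
    then obtain f where "move D E f \<or> move E D f" by blast
    then have "link_diagram E \<and> card (components D) = card (components E) \<and>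
      (classical D \<longleftrightarrow> classical E) \<and> cts_isotopic (D, singletons D) (E, singletons E)"
    proof
      assume m: "move D E f"
      then have "link_diagram E" by (simp add: move_def)
      with bij_betw_same_card[OF move_components[OF m]] move_classical[OF m]
        cts_isotopic_singletons_if_move[OF m] show ?thesis by simp
    next
      assume m: "move E D f"
      then have "link_diagram E" by (simp add: move_def)
      with bij_betw_same_card[OF move_components[OF m]] move_classical[OF m]
        cts_isotopic_sym[OF cts_isotopic_singletons_if_move[OF m]] show ?thesis by simp
    qed
    with step.IH show ?case by (auto intro: cts_isotopic_trans)
  qed
  then show "link_diagram D" "card (components L) = card (components D)"
    "classical L \<longleftrightarrow> classical D" "cts_isotopic (L, singletons L) (D, singletons D)"
    by simp_all
qed

subsection \<open>Faces and pieces\<close>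

lemma corners_subset: "arc_graph D \<Longrightarrow> corners D \<subseteq> (arcs D \<times> UNIV) \<times> (arcs D \<times> UNIV)"
  by (auto simp: corners_def src_in_arcs tgt_in_arcs)

lemma pieces_eq:
  "pieces D = classes (arcs D) (strands D \<union> {(src D (c, Rightward), src D (c, Leftward)) | c. c \<in> crossings D})"
  by (simp add: pieces_def strands_def)

lemma add_unknot_simps [simp]:
  "arcs (add_unknot D u) = insert u (arcs D)" "crossings (add_unknot D u) = crossings D"
  "kind (add_unknot D u) = kind D" "src (add_unknot D u) = src D" "tgt (add_unknot D u) = tgt D"
  by (simp_all add: add_unknot_def)

lemma UNIV_side: "UNIV = {Lft, Rgt}"
  using side.exhaust by auto

lemma components_add_unknot:
  assumes "arc_graph D" and "u \<notin> arcs D"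
  shows "components (add_unknot D u) = insert {u} (components D)" "{u} \<notin> components D"
  using classes_insert_isolated[OF assms(2) strands_subset[OF assms(1)]]
  by (simp_all add: components_eq strands_def)

text \<open>The circle adds one piece and two faces, its two sides, which keeps Euler's formula
  balanced.\<close>

lemma link_diagram_add_unknot:
  assumes "link_diagram D" and "u \<notin> arcs D"
  shows "link_diagram (add_unknot D u)"
proof -
  note D = arc_graph_if_link_diagram[OF assms(1)]
  then have fin: "finite (arcs D)" by (simp add: arc_graph_def)
  let ?A = "arcs D \<times> (UNIV :: side set)"
  have "faces (add_unknot D u) = classes (insert (u, Lft) (insert (u, Rgt) ?A)) (corners D)"
    unfolding faces_def corners_def add_unknot_simps
    by (rule arg_cong[where f = "\<lambda>A. classes A _"]) (auto simp: UNIV_side)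
  moreover have "corners D \<subseteq> ?A \<times> ?A" by (rule corners_subset[OF D])
  ultimately have "card (faces (add_unknot D u)) = Suc (Suc (card (faces D)))"
    using assms(2) fin unfolding faces_def
    by (subst card_classes_insert_isolated card_classes_insert_isolated[symmetric];
        auto simp: UNIV_side)+
  moreover have "card (pieces (add_unknot D u)) = Suc (card (pieces D))"
    unfolding pieces_eq add_unknot_simps strands_def
    using assms(2) fin src_in_arcs[OF D] tgt_in_arcs[OF D]
    by (intro card_classes_insert_isolated) auto
  moreover have "arc_graph (add_unknot D u)"
    using D by (auto simp: arc_graph_def)
  ultimately show ?thesis
    using assms(1) by (simp add: link_diagram_iff)
qed

text \<open>Removing a kink loses the face \<open>(m, z0)\<close> inside its loop \<open>m\<close>.  As the loop turns back, the other
  side of \<open>m\<close> is adjacent to the sides \<open>z0\<close>, and not \<open>z1\<close>, of the strand before and after it.\<close>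

lemma link_diagram_kink:
  assumes K: "arc_graph K" and n: "n \<in> crossings K" and m: "tgt K (n, h) = src K (n, opp h)"
    and er: "erases K {n} D g" and D: "link_diagram D"
  shows "link_diagram K"
proof -
  note E = resolvesD[OF er[unfolded erases_def]]
  note KS = src_in_arcs[OF K] tgt_in_arcs[OF K]
  define m where "m = tgt K (n, h)"
  define i where "i = src K (n, h)"
  define out where "out = tgt K (n, opp h)"
  have ms: "src K (n, opp h) = m" using m by (simp add: m_def)
  have neq: "i \<noteq> m" "out \<noteq> m"
    using src_eq_iff[OF K n n, of h "opp h"] tgt_eq_iff[OF K n n, of "opp h" h] ms by (auto simp: i_def m_def out_def)
  have away: "src K (d, k) \<noteq> m" "tgt K (d, k) \<noteq> m" if "d \<in> crossings K" "d \<noteq> n" for d k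
    using that src_eq_iff[OF K that(1) n, of k "opp h"] tgt_eq_iff[OF K that(1) n, of k h] ms
    by (auto simp: m_def)
  have mem: "m \<in> arcs K" "i \<in> arcs K" "out \<in> arcs K"
    using n KS by (simp_all add: m_def i_def out_def)
  have ends: "src K (n, k) \<in> {i, m, out}" "tgt K (n, k) \<in> {i, m, out}" for k
    using dir_eq_opp[of k h] ms by (auto simp: i_def m_def out_def)
  let ?G = "{(src K (c, h), tgt K (c, h)) | c h. c \<in> {n}}"
  have G: "?G = {(i, m), (m, out)}"
    using dir_eq_opp[of _ h] ms by (force simp: i_def m_def out_def)
  have eqs: "g i = g m" "g out = g m"
    using E(6)[unfolded G] mem by (auto intro: conn_base conn_sym)
  have fib: "a = b \<or> {a, b} \<subseteq> {i, m, out}" if "a \<in> arcs K" "b \<in> arcs K" "g a = g b" for a b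
  proof -
    have "(a, b) \<in> conn {(i, m), (m, out)}" using E(6)[unfolded G] that by simp
    \<comment> \<open>The three glued arcs get the common representative \<open>i\<close>, every
      other arc represents itself.\<close>
    then have "(if a \<in> {i, m, out} then i else a) = (if b \<in> {i, m, out} then i else b)"
      by (rule conn_invariant[where k = "\<lambda>x. if x \<in> {i, m, out} then i else x"]) auto
    then show ?thesis by (auto split: if_splits)
  qed

  define r where "r = strands K \<union> {(src K (c, Rightward), src K (c, Leftward)) | c. c \<in> crossings K}"
  \<comment> \<open>The arcs \<open>i\<close>, \<open>m\<close> and \<open>out\<close> follow each
    other on one strand, so gluing them leaves the pieces alone.\<close>
  have "bij_betw ((`) g) (pieces K) (pieces D)"
    unfolding pieces_eq r_def[symmetric]
  proof (rule classes_bij)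
    show "g ` arcs K = arcs D" by (rule E)
    show "r \<subseteq> arcs K \<times> arcs K" by (auto simp: r_def strands_def KS)
    let ?s = "strands D \<union> {(src D (c, Rightward), src D (c, Leftward)) | c. c \<in> crossings D}"
    show "(g a, g b) \<in> conn ?s" if ab: "(a, b) \<in> r" for a b
    proof -
      from ab obtain d where d: "d \<in> crossings K"
        "(\<exists>k. a = src K (d, k) \<and> b = tgt K (d, k)) \<or> a = src K (d, Rightward) \<and> b = src K (d, Leftward)"
        by (auto simp: r_def strands_def)
      show ?thesis
      proof (cases "d = n")
        case True
        then have "{a, b} \<subseteq> {i, m, out}"
          using d(2) ends by auto
        then have "g a = g b" using eqs by auto
        then show ?thesis by simp
      next
        case False
        with d(1) have dD: "d \<in> crossings D" by (simp add: E(2))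
        then have "(src D (d, k), tgt D (d, k)) \<in> conn ?s" for k
          by (intro conn_base UnI1) (auto simp: strands_def)
        moreover have "(src D (d, Rightward), src D (d, Leftward)) \<in> conn ?s"
          using dD by (intro conn_base UnI2) auto
        ultimately show ?thesis using d(2) E(4,5)[OF dD] by auto
      qed
    qed
    show "\<exists>a\<in>arcs K. \<exists>b\<in>arcs K. g a = w \<and> g b = z \<and> (a, b) \<in> conn r"
      if "(w, z) \<in> ?s" for w z
    proof -
      from that obtain d where d: "d \<in> crossings D"
        "(\<exists>k. w = src D (d, k) \<and> z = tgt D (d, k)) \<or> w = src D (d, Rightward) \<and> z = src D (d, Leftward)"
        by (auto simp: strands_def)
      then have dK: "d \<in> crossings K" by (simp add: E(2))
      have "(src K (d, k), tgt K (d, k)) \<in> conn r" for k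
        using dK by (intro conn_base) (auto simp: r_def strands_def)
      moreover have "(src K (d, Rightward), src K (d, Leftward)) \<in> conn r"
        using dK by (intro conn_base) (auto simp: r_def)
      ultimately show ?thesis
        using d(2) KS[OF dK] E(4,5)[OF d(1)] by metis
    qed
    have "conn ?G \<subseteq> conn r"
      using n by (intro conn_subset) (auto simp: r_def strands_def intro!: conn_base)
    then show "(a, b) \<in> conn r" if "a \<in> arcs K" "b \<in> arcs K" "g a = g b" for a b
      using E(6)[OF that(1,2)] that(3) by blast
  qed
  then have pieces: "card (pieces K) = card (pieces D)" by (rule bij_betw_same_card)

  \<comment> \<open>\<open>z0\<close> is the side of the loop that faces the monogon: a loop that
    leaves \<open>Rightward\<close> and returns \<open>Leftward\<close> turns clockwise and has its
    inside on the right; the other case is the mirror image.\<close>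
  define z0 where "z0 = (if h = Rightward then Rgt else Lft)"
  define z1 where "z1 = (if h = Rightward then Lft else Rgt)"
  have z: "z0 \<noteq> z1" "z = z0 \<or> z = z1" for z
    by (cases z; simp add: z0_def z1_def)+
  define A where "A = arcs K \<times> UNIV - {(m, z0)}"
  define t where "t = corners K - {((m, z0), (m, z0))}"
  \<comment> \<open>On \<open>A\<close> the arc \<open>m\<close> occurs with the side
    \<open>z1\<close> only; it has to be sent to the side \<open>z0\<close> of the glued arc, which
    it adjoins.\<close>
  define F where "F = (\<lambda>(x, z). (g x, if x = m then z0 else z))"
  let ?at = "\<lambda>D c. {((tgt D (c, Leftward), Rgt), (tgt D (c, Rightward), Lft)),
      ((tgt D (c, Rightward), Rgt), (src D (c, Leftward), Rgt)),
      ((src D (c, Rightward), Rgt), (src D (c, Leftward), Lft)),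
      ((tgt D (c, Leftward), Lft), (src D (c, Rightward), Lft))}"
  have C: "corners D = (\<Union>c\<in>crossings D. ?at D c)" for D
    by (simp add: corners_def)
  have at_n: "h = Rightward \<Longrightarrow> ?at K n = {((out, z0), (m, z1)), ((m, z0), (m, z0)), ((i, z0), (m, z1)), ((out, z1), (i, z1))}"
    "h = Leftward \<Longrightarrow> ?at K n = {((m, z1), (out, z0)), ((out, z1), (i, z1)), ((m, z1), (i, z0)), ((m, z0), (m, z0))}"
    using ms by (auto simp: i_def m_def out_def z0_def z1_def)
  have at_n': "?at K n - {((m, z0), (m, z0))} =
      (if h = Rightward then {((out, z0), (m, z1)), ((i, z0), (m, z1)), ((out, z1), (i, z1))}
       else {((m, z1), (out, z0)), ((out, z1), (i, z1)), ((m, z1), (i, z0))})"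
    using at_n z neq by (cases h) auto
  have at_d: "?at K d \<subseteq> A \<times> A" if "d \<in> crossings K" "d \<noteq> n" for d
    using away[OF that] KS[OF that(1)] by (auto simp: A_def)
  have t: "t = (?at K n - {((m, z0), (m, z0))}) \<union> (\<Union>d\<in>crossings K - {n}. ?at K d)"
  proof -
    have "((m, z0), (m, z0)) \<notin> ?at K d" if "d \<in> crossings K - {n}" for d
      using at_d[of d] that by (auto simp: A_def)
    then have out_d: "((m, z0), (m, z0)) \<notin> (\<Union>d\<in>crossings K - {n}. ?at K d)" by blast
    have split: "corners K = ?at K n \<union> (\<Union>d\<in>crossings K - {n}. ?at K d)"
      unfolding C using n by blast
    have "p \<notin> Y \<Longrightarrow> (X \<union> Y) - {p} = (X - {p}) \<union> Y" for X Y :: "'b set" and p by blast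
    from this[OF out_d] show ?thesis unfolding t_def split .
  qed
  have tA: "t \<subseteq> A \<times> A"
  proof -
    have "?at K n - {((m, z0), (m, z0))} \<subseteq> A \<times> A"
      unfolding at_n' using z(1) neq mem by (auto simp: A_def)
    moreover have "(\<Union>d\<in>crossings K - {n}. ?at K d) \<subseteq> A \<times> A" using at_d by blast
    ultimately show ?thesis unfolding t by blast
  qed
  have tn: "((m, z1), (i, z0)) \<in> conn t" "((m, z1), (out, z0)) \<in> conn t" "((i, z1), (out, z1)) \<in> conn t"
  proof -
    have "?at K n - {((m, z0), (m, z0))} \<subseteq> t" unfolding t by blast
    then have "((m, z1), (i, z0)) \<in> t \<or> ((i, z0), (m, z1)) \<in> t"
      "((m, z1), (out, z0)) \<in> t \<or> ((out, z0), (m, z1)) \<in> t"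
      "((i, z1), (out, z1)) \<in> t \<or> ((out, z1), (i, z1)) \<in> t"
      unfolding at_n' by (simp_all split: if_splits)
    then show "((m, z1), (i, z0)) \<in> conn t" "((m, z1), (out, z0)) \<in> conn t" "((i, z1), (out, z1)) \<in> conn t"
      by (blast intro: conn_base conn_sym[OF conn_base])+
  qed
  have at_D: "?at D d = (\<lambda>(p, q). (F p, F q)) ` ?at K d" if "d \<in> crossings D" for d
  proof -
    have "d \<in> crossings K" "d \<noteq> n" using that by (simp_all add: E(2))
    then show ?thesis using away[of d] by (simp add: F_def E(4,5)[OF that])
  qed
  have "bij_betw ((`) F) (classes A t) (faces D)"
    unfolding faces_def
  proof (rule classes_bij)
    show "F ` A = arcs D \<times> UNIV"
    proof (intro equalityI subsetI)
      fix p assume "p \<in> arcs D \<times> (UNIV :: side set)"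
      then obtain x k where p: "p = (g x, k)" "x \<in> arcs K" using E(1) by blast
      show "p \<in> F ` A"
      proof (cases "x = m")
        case True
        then have "p = F (i, k)" using p eqs neq by (simp add: F_def)
        then show ?thesis using mem neq by (auto simp: A_def)
      next
        case False
        then show ?thesis using p by (force simp: A_def F_def)
      qed
    qed (use E(1) in \<open>auto simp: A_def F_def\<close>)
    show "t \<subseteq> A \<times> A" by (rule tA)
    show "(F p, F q) \<in> conn (corners D)" if "(p, q) \<in> t" for p q
      using that unfolding t
    proof
      assume "(p, q) \<in> ?at K n - {((m, z0), (m, z0))}"
      then have "F p = F q"
        unfolding at_n' using neq eqs by (auto simp: F_def split: if_splits)
      then show ?thesis by simp
    next
      assume "(p, q) \<in> (\<Union>d\<in>crossings K - {n}. ?at K d)"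
      then obtain d where d: "d \<in> crossings K" "d \<noteq> n" "(p, q) \<in> ?at K d" by blast
      then have "d \<in> crossings D" by (simp add: E(2))
      moreover from this have "(F p, F q) \<in> ?at D d"
        using imageI[OF d(3), of "\<lambda>(p, q). (F p, F q)"]
        unfolding at_D[OF \<open>d \<in> crossings D\<close>] by (simp only: case_prod_conv)
      ultimately show ?thesis unfolding C by (blast intro: conn_base)
    qed
    show "\<exists>p\<in>A. \<exists>q\<in>A. F p = p' \<and> F q = q' \<and> (p, q) \<in> conn t" if pq: "(p', q') \<in> corners D" for p' q'
    proof -
      from pq obtain d where d: "d \<in> crossings D" "(p', q') \<in> ?at D d" unfolding C by blast
      then have dK: "d \<in> crossings K" "d \<noteq> n" by (simp_all add: E(2))
      have "(F p, F q) = (p', q') \<Longrightarrow> (p, q) \<in> ?at K d \<Longrightarrow> ?thesis" for p q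
        using at_d[OF dK] dK unfolding t by (blast intro: conn_base)
      moreover have "\<exists>p q. (F p, F q) = (p', q') \<and> (p, q) \<in> ?at K d"
        using d(2) unfolding at_D[OF d(1)] by (elim imageE) fastforce
      ultimately show ?thesis by blast
    qed
    show "(p, q) \<in> conn t" if pq: "p \<in> A" "q \<in> A" "F p = F q" for p q
    proof -
      obtain a k b l where p: "p = (a, k)" "q = (b, l)" by fastforce
      have ab: "a \<in> arcs K" "b \<in> arcs K" "g a = g b" "(if a = m then z0 else k) = (if b = m then z0 else l)"
        and z1: "a = m \<Longrightarrow> k = z1" "b = m \<Longrightarrow> l = z1"
        using pq z(2) by (auto simp: p A_def F_def)
      \<comment> \<open>On the side \<open>z0\<close> the arcs before and after the loop are
        adjacent by way of the outside of \<open>m\<close>; on the side \<open>z1\<close> they meet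
        directly, in the sector opposite to the monogon.\<close>
      have io: "((x, k), (y, k)) \<in> conn t" if "x \<in> {i, out}" "y \<in> {i, out}" for x y k
      proof -
        have "((i, k), (out, k)) \<in> conn t"
          using z(2)[of k] tn conn_trans[OF conn_sym[OF tn(1)] tn(2)] by auto
        with conn_sym[OF this] that show ?thesis by auto
      qed
      have mi: "((m, z1), (x, z0)) \<in> conn t" if "x \<in> {i, out}" for x
        using that tn by auto
      show ?thesis
        using fib[OF ab(1-3)] ab(4) z1 io mi mi[THEN conn_sym] unfolding p
        by (cases "a = m"; cases "b = m") auto
    qed
  qed
  then have "card (classes A t) = card (faces D)" by (rule bij_betw_same_card)
  moreover have "faces K = classes (insert (m, z0) A) t"
  proof -
    have "((m, z0), (m, z0)) \<in> corners K"
    proof -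
      have "((m, z0), (m, z0)) \<in> ?at K n"
      proof (cases h)
        case Rightward
        show ?thesis unfolding at_n(1)[OF Rightward] by simp
      next
        case Leftward
        show ?thesis unfolding at_n(2)[OF Leftward] by simp
      qed
      with n show ?thesis unfolding C by (rule UN_I)
    qed
    \<comment> \<open>The corner left out of \<open>t\<close> relates a side to itself, so restoring
      it does not change the generated classes; only the isolated element \<open>(m, z0)\<close> is
      new.\<close>
    then have "corners K = insert ((m, z0), (m, z0)) t" unfolding t_def by blast
    moreover have "arcs K \<times> UNIV = insert (m, z0) A" using mem by (auto simp: A_def)
    ultimately show ?thesis unfolding faces_def by (simp add: classes_eq)
  qed
  moreover have "finite A" "(m, z0) \<notin> A"
    using K by (auto simp: A_def arc_graph_def UNIV_side)
  ultimately have "card (faces K) = Suc (card (faces D))"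
    using card_classes_insert_isolated[of "(m, z0)" A t] tA by simp
  moreover have "card (crossings K) = Suc (card (crossings D))"
    using n K unfolding E(2) arc_graph_def by (metis card_Suc_Diff1)
  ultimately show ?thesis
    using D K pieces by (simp add: link_diagram_iff)
qed

subsection \<open>Smoothing a crossing without loops\<close>

text \<open>Glued arcs are represented by the outgoing one. If no arc both leaves and enters
  \<open>s\<close>, a representative is never itself replaced, so a single substitution is
  enough.\<close>

definition reroute :: "diagram \<Rightarrow> nat \<Rightarrow> nat \<Rightarrow> nat" where
  "reroute D s x = (if x = src D (s, Rightward) then tgt D (s, Leftward)
     else if x = src D (s, Leftward) then tgt D (s, Rightward) else x)"

definition smooth :: "diagram \<Rightarrow> nat \<Rightarrow> diagram" where
  "smooth D s = D\<lparr>arcs := arcs D - src D ` ({s} \<times> UNIV), crossings := crossings D - {s},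
     src := reroute D s \<circ> src D, tgt := reroute D s \<circ> tgt D\<rparr>"

lemma smooth_simps [simp]:
  "arcs (smooth D s) = arcs D - src D ` ({s} \<times> UNIV)" "crossings (smooth D s) = crossings D - {s}"
  "kind (smooth D s) = kind D" "src (smooth D s) p = reroute D s (src D p)"
  "tgt (smooth D s) p = reroute D s (tgt D p)"
  by (simp_all add: smooth_def)

lemma reroute_other: "(\<And>h. x \<noteq> src D (s, h)) \<Longrightarrow> reroute D s x = x"
  by (simp add: reroute_def)

context
  fixes D s
  assumes D: "arc_graph D" and s: "s \<in> crossings D" and noloop: "\<And>h k. src D (s, h) \<noteq> tgt D (s, k)"
begin

lemma reroute_src: "reroute D s (src D (s, h)) = tgt D (s, opp h)"
  using src_eq_iff[OF D s s] by (cases h) (simp_all add: reroute_def)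

lemma reroute_tgt: "reroute D s (tgt D (s, h)) = tgt D (s, h)"
  using noloop by (metis reroute_other)

lemma reroute_cases:
  obtains h where "x = src D (s, h)" | "\<And>h. x \<noteq> src D (s, h)"
  by blast

lemma reroute_image: "reroute D s ` arcs D = arcs D - src D ` ({s} \<times> UNIV)"
proof (intro equalityI subsetI)
  fix y assume "y \<in> reroute D s ` arcs D"
  then obtain x where x: "x \<in> arcs D" "y = reroute D s x" by blast
  show "y \<in> arcs D - src D ` ({s} \<times> UNIV)"
  proof (cases x rule: reroute_cases)
    case (1 h)
    then have "y = tgt D (s, opp h)" using x by (simp add: reroute_src)
    then show ?thesis using tgt_in_arcs[OF D s, of "opp h"] noloop[symmetric] by auto
  next
    case 2
    then show ?thesis using x by (auto simp: reroute_other)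
  qed
next
  fix y assume "y \<in> arcs D - src D ` ({s} \<times> UNIV)"
  then have "y \<in> arcs D" "reroute D s y = y" by (auto intro!: reroute_other)
  then show "y \<in> reroute D s ` arcs D" by (metis imageI)
qed

lemma smoothing_smooth: "smoothing D s (smooth D s) (reroute D s)"
proof -
  let ?q = "reroute D s" and ?G = "{(src D (s, h), tgt D (s, opp h)) | h. True}"
  have to_q: "(x, ?q x) \<in> conn ?G" for x
  proof (cases x rule: reroute_cases)
    case (1 h)
    then show ?thesis by (auto simp: reroute_src intro: conn_base)
  next
    case 2
    then show ?thesis by (simp add: reroute_other)
  qed
  have "?q e = ?q e' \<longleftrightarrow> (e, e') \<in> conn ?G" for e e'
  proof
    assume "?q e = ?q e'"
    with to_q[of e] conn_sym[OF to_q[of e']] show "(e, e') \<in> conn ?G"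
      by (simp add: conn_trans)
  next
    assume "(e, e') \<in> conn ?G"
    then show "?q e = ?q e'"
      by (rule conn_invariant) (auto simp: reroute_src reroute_tgt)
  qed
  then show ?thesis
    unfolding smoothing_def resolves_def conn_def by (simp add: reroute_image)
qed

text \<open>The point is that sources and targets still match: among the targets of the remaining
  passages, \<open>reroute\<close> trades the arcs entering \<open>s\<close> for those leaving it,
  and the result is exactly the set of remaining sources.\<close>

lemma arc_graph_smooth: "arc_graph (smooth D s)"
proof -
  let ?q = "reroute D s" and ?X = "(crossings D - {s}) \<times> (UNIV :: dir set)"
  let ?s = "{s} \<times> (UNIV :: dir set)"
  have X: "crossings D \<times> UNIV = ?X \<union> ?s" "?X \<inter> ?s = {}" using s by auto
  have inj: "inj_on (src D) (?X \<union> ?s)" "inj_on (tgt D) (?X \<union> ?s)"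
    and st: "src D ` (?X \<union> ?s) = tgt D ` (?X \<union> ?s)" and sub: "src D ` (?X \<union> ?s) \<subseteq> arcs D"
    using D unfolding arc_graph_def X(1) by blast+
  have nsrc: "src D ` ?X \<inter> src D ` ?s = {}" and ntgt: "tgt D ` ?X \<inter> tgt D ` ?s = {}"
    using inj X(2) by (metis Un_upper1 Un_upper2 image_empty inj_on_image_Int)+
  have st_s: "src D ` ?s \<inter> tgt D ` ?s = {}" using noloop by auto
  have q_src: "?q (src D p) = src D p" if "p \<in> ?X" for p
    using that nsrc by (intro reroute_other) auto
  have q_s: "?q ` src D ` ?s = tgt D ` ?s"
  proof -
    have "?q ` src D ` ?s = (\<lambda>h. tgt D (s, opp h)) ` UNIV"
      by (auto simp: image_iff reroute_src)
    also have "\<dots> = tgt D ` ?s"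
      by (auto simp: image_iff) (metis opp_simps(1))
    finally show ?thesis .
  qed
  have q_fix: "?q ` Y = Y" if "Y \<inter> src D ` ?s = {}" for Y
  proof -
    have "?q y = y" if "y \<in> Y" for y
      using that \<open>Y \<inter> src D ` ?s = {}\<close> by (intro reroute_other) auto
    then show ?thesis by simp
  qed
  have src': "(\<lambda>p. ?q (src D p)) ` ?X = src D ` ?X"
    using q_src by (intro image_cong) auto
  \<comment> \<open>The arcs at crossings are split by the passages through \<open>s\<close> twice,
    as sources and as targets; comparing the two splittings determines the targets of the other
    passages.\<close>
  have tX: "tgt D ` ?X = (src D ` ?X - tgt D ` ?s) \<union> src D ` ?s"
  proof -
    have "Y = (X - Z) \<union> W" if "X \<union> W = Y \<union> Z" "X \<inter> W = {}" "Y \<inter> Z = {}" "W \<inter> Z = {}"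
      for X Y Z W :: "nat set" using that by blast
    from this[OF st[unfolded image_Un] nsrc ntgt st_s] show ?thesis .
  qed
  have sX: "src D ` ?X = (src D ` ?X - tgt D ` ?s) \<union> tgt D ` ?s"
  proof -
    have "X = (X - Z) \<union> Z" if "X \<union> W = Y \<union> Z" "W \<inter> Z = {}"
      for X Y Z W :: "nat set" using that by blast
    from this[OF st[unfolded image_Un] st_s] show ?thesis .
  qed
  have "(src D ` ?X - tgt D ` ?s) \<inter> src D ` ?s = {}" using nsrc by blast
  note fixed = q_fix[OF this]
  have "(\<lambda>p. ?q (tgt D p)) ` ?X = ?q ` tgt D ` ?X" by (simp add: image_image)
  also have "\<dots> = (src D ` ?X - tgt D ` ?s) \<union> tgt D ` ?s"
    by (simp only: tX image_Un q_s fixed)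
  also have "\<dots> = src D ` ?X" by (rule sX[symmetric])
  finally have tgt': "(\<lambda>p. ?q (tgt D p)) ` ?X = src D ` ?X" .
  have "inj_on ?q (tgt D ` ?X)"
  proof (rule inj_onI)
    fix x y assume xy: "x \<in> tgt D ` ?X" "y \<in> tgt D ` ?X" "?q x = ?q y"
    have notin: "x \<noteq> tgt D (s, k)" "y \<noteq> tgt D (s, k)" for k
      using xy ntgt by auto
    show "x = y"
    proof (cases x rule: reroute_cases)
      case (1 k)
      note x = this
      show ?thesis
      proof (cases y rule: reroute_cases)
        case (1 l)
        with x xy(3) show ?thesis by (simp add: reroute_src tgt_eq_iff[OF D s s])
      next
        case 2
        with x xy(3) notin(2)[of "opp k"] show ?thesis by (simp add: reroute_src reroute_other)
      qed
    next
      case 2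
      note x = this
      show ?thesis
      proof (cases y rule: reroute_cases)
        case (1 l)
        with x xy(3) notin(1)[of "opp l"] show ?thesis by (simp add: reroute_src reroute_other)
      next
        case 2
        with x xy(3) show ?thesis by (simp add: reroute_other)
      qed
    qed
  qed
  moreover have "inj_on (tgt D) ?X" using inj by (simp add: inj_on_Un)
  ultimately have "inj_on (\<lambda>p. ?q (tgt D p)) ?X" by (simp add: comp_inj_on_iff[symmetric, unfolded comp_def])
  moreover have "inj_on (\<lambda>p. ?q (src D p)) ?X"
  proof -
    have "inj_on (src D) ?X" using inj by (simp add: inj_on_Un)
    then show ?thesis using q_src by (subst inj_on_cong[where g = "src D"]) auto
  qed
  moreover have "src D ` ?X \<subseteq> arcs D - src D ` ?s" using sub nsrc by auto
  \<comment> \<open>This arc witnesses that the smoothing still has an arc.\<close>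
  moreover have "tgt D (s, Rightward) \<in> arcs D - src D ` ?s"
    using tgt_in_arcs[OF D s, of Rightward] noloop[symmetric] by auto
  ultimately show ?thesis
    using D src' tgt' unfolding arc_graph_def by (simp add: smooth_def comp_def) blast
qed

end

lemma component_subset_imp_eq:
  "C \<in> components D \<Longrightarrow> C' \<in> components D \<Longrightarrow> C \<subseteq> C' \<Longrightarrow> C = C'"
  using component_nonempty[of C D] components_disjoint[of C D C'] by blast

text \<open>With \<open>Ca = Cb\<close> the new block is a singleton, so one formula serves the
  crossing of two components and the self-crossing of one.\<close>

lemma merge_singletons:
  assumes "Ca \<in> components D" "Cb \<in> components D" "src D (s, h) \<in> Ca" "src D (s, opp h) \<in> Cb"
  shows "merge D s (singletons D) = insert {Ca, Cb} ((\<lambda>C. {C}) ` (components D - {Ca, Cb}))"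
proof -
  have "(\<exists>k. src D (s, k) \<in> X) \<longleftrightarrow> X = Ca \<or> X = Cb" if "X \<in> components D" for X
  proof -
    have "(\<exists>k. src D (s, k) \<in> X) \<longleftrightarrow> src D (s, h) \<in> X \<or> src D (s, opp h) \<in> X"
      using dir_eq_opp[of _ h] by metis
    moreover have "src D (s, h) \<in> X \<longleftrightarrow> X = Ca" "src D (s, opp h) \<in> X \<longleftrightarrow> X = Cb"
      using components_disjoint[OF that] assms by auto
    ultimately show ?thesis by simp
  qed
  then have M: "{B \<in> singletons D. \<exists>C\<in>B. \<exists>k. src D (s, k) \<in> C} = {{Ca}, {Cb}}"
    using assms(1,2) by (auto simp: singletons_def)
  have "singletons D - {{Ca}, {Cb}} = (\<lambda>C. {C}) ` (components D - {Ca, Cb})"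
    by (auto simp: singletons_def)
  then show ?thesis
    unfolding merge_def M Let_def by (simp add: insert_commute)
qed

lemma partition_merge_singletons:
  assumes "Ca \<in> components D" "Cb \<in> components D" "src D (s, h) \<in> Ca" "src D (s, opp h) \<in> Cb"
  shows "partition_on (components D) (merge D s (singletons D))"
  unfolding merge_singletons[OF assms] using assms(1,2)
  by (auto simp: partition_on_def disjoint_def)

lemma component_of:
  assumes "e \<in> arcs D"
  obtains C where "C \<in> components D" "e \<in> C"
  using class_in_classes[OF assms, of "strands D"] unfolding components_eq by auto

text \<open>By \<open>con\<close> the smoothed strands lie on one component of \<open>D0\<close>.
  The smoothing thus fuses just those components whose blocks \<open>merge\<close> has united, and
  each block ends up with a single component.\<close>

lemma carry_smoothing_singletons:
  assumes D: "arc_graph D" and s: "s \<in> crossings D" and sm: "smoothing D s D0 q"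
    and con: "(q (src D (s, Rightward)), q (src D (s, Leftward))) \<in> conn (strands D0)"
  shows "carry q D0 (merge D s (singletons D)) = singletons D0"
proof -
  note E = resolvesD[OF sm[unfolded smoothing_def]]
  define a where "a = src D (s, Rightward)"
  define b where "b = src D (s, Leftward)"
  \<comment> \<open>The classes of \<open>r\<close> are the unions of the blocks after the merger;
    the map \<open>q\<close> turns them into the components of \<open>D0\<close>.\<close>
  define r where "r = insert (a, b) (strands D)"
  have ab: "a \<in> arcs D" "b \<in> arcs D" using src_in_arcs[OF D s] by (simp_all add: a_def b_def)
  have st: "(src D (d, h), tgt D (d, h)) \<in> conn r" if "d \<in> crossings D" for d h
    using that by (intro conn_base) (auto simp: r_def strands_def)
  have srcs: "(src D (s, h), src D (s, k)) \<in> conn r" for h k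
  proof -
    have "(a, b) \<in> conn r" by (intro conn_base) (simp add: r_def)
    with conn_sym[OF this] show ?thesis by (cases h; cases k) (simp_all add: a_def b_def)
  qed
  have srcs0: "(q (src D (s, h)), q (src D (s, k))) \<in> conn (strands D0)" for h k
    using con conn_sym[OF con] by (cases h; cases k) simp_all
  let ?G = "{(src D (s, h), tgt D (s, opp h)) | h. True}"
  have G: "q (src D (s, h)) = q (tgt D (s, opp h))" for h
    using E(6)[of "src D (s, h)" "tgt D (s, opp h)"] src_in_arcs[OF D s] tgt_in_arcs[OF D s]
    by (auto intro: conn_base)
  have bij: "bij_betw ((`) q) (classes (arcs D) r) (components D0)"
    unfolding components_eq
  proof (rule classes_bij)
    show "q ` arcs D = arcs D0" by (rule E)
    show "r \<subseteq> arcs D \<times> arcs D" using strands_subset[OF D] ab by (auto simp: r_def)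
    show "(q x, q y) \<in> conn (strands D0)" if xy: "(x, y) \<in> r" for x y
    proof (cases "(x, y) = (a, b)")
      case True
      then show ?thesis using con by (simp add: a_def b_def)
    next
      case False
      with xy obtain d h where d: "x = src D (d, h)" "y = tgt D (d, h)" "d \<in> crossings D"
        by (auto simp: r_def strands_def)
      show ?thesis
      proof (cases "d = s")
        case True
        then show ?thesis using d srcs0[of h "opp h"] G[of "opp h"] by simp
      next
        case False
        with d have "d \<in> crossings D0" by (simp add: E(2))
        then show ?thesis
          unfolding d by (intro conn_base) (auto simp: strands_def E(4,5)[symmetric])
      qed
    qed
    show "\<exists>x\<in>arcs D. \<exists>y\<in>arcs D. q x = w \<and> q y = z \<and> (x, y) \<in> conn r"
      if "(w, z) \<in> strands D0" for w z
    proof -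
      from that obtain d h where d: "w = src D0 (d, h)" "z = tgt D0 (d, h)" "d \<in> crossings D0"
        by (auto simp: strands_def)
      then have "d \<in> crossings D" by (simp add: E(2))
      then show ?thesis
        using st[of d h] E(4,5)[OF d(3)] d src_in_arcs[OF D, of d h] tgt_in_arcs[OF D, of d h] by metis
    qed
    have "(src D (s, h), tgt D (s, opp h)) \<in> conn r" for h
      by (rule conn_trans[OF srcs st[OF s]])
    then have "conn ?G \<subseteq> conn r" by (intro conn_subset) auto
    then show "(x, y) \<in> conn r" if "x \<in> arcs D" "y \<in> arcs D" "q x = q y" for x y
      using E(6)[OF that(1,2)] that(3) by blast
  qed
  define Ca where "Ca = conn (strands D) `` {a}"
  define Cb where "Cb = conn (strands D) `` {b}"
  have C: "Ca \<in> components D" "Cb \<in> components D" "a \<in> Ca" "b \<in> Cb"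
    using ab by (auto simp: components_eq Ca_def Cb_def intro: class_in_classes)
  let ?J = "merge D s (singletons D)"
  have J: "?J = insert {Ca, Cb} ((\<lambda>C. {C}) ` (components D - {Ca, Cb}))"
    using C by (intro merge_singletons[of _ _ _ _ Rightward]) (simp_all add: a_def b_def)
  have "Union ` ?J = insert (Ca \<union> Cb) (components D - {Ca, Cb})"
    unfolding J by (simp add: image_image)
  also have "\<dots> = classes (arcs D) r"
    unfolding r_def classes_insert_pair[OF ab strands_subset[OF D]] components_eq Ca_def Cb_def ..
  finally have UJ: "Union ` ?J = classes (arcs D) r" .
  have "carry q D0 ?J = (\<lambda>B. {q ` \<Union>B}) ` ?J"
    unfolding carry_def
  proof (rule image_cong[OF refl])
    fix B assume "B \<in> ?J"
    then have "q ` \<Union>B \<in> components D0" using UJ bij_betwE[OF bij] by blast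
    then show "{C \<in> components D0. C \<subseteq> q ` \<Union>B} = {q ` \<Union>B}"
      using component_subset_imp_eq[of _ D0 "q ` \<Union>B"] by blast
  qed
  also have "\<dots> = (\<lambda>X. {X}) ` (`) q ` Union ` ?J" by (simp add: image_image)
  also have "\<dots> = singletons D0"
    unfolding UJ bij_betw_imp_surj_on[OF bij] by (simp add: singletons_def)
  finally show ?thesis .
qed

subsection \<open>Adding a circle\<close>

lemma erases_set_kind: "c \<in> T \<Longrightarrow> erases (set_kind D c k) T D' f \<longleftrightarrow> erases D T D' f"
  by (auto simp: erases_def resolves_def)

lemma bigon_set_kind [simp]: "bigon (set_kind D s k) c c' \<longleftrightarrow> bigon D c c'"
  by (simp add: bigon_def joins_def)

text \<open>\<open>c\<close> and \<open>c'\<close> are named in the order in which the strand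
  crosses the circle, \<open>s\<close> and \<open>n\<close> by their kinds; keeping both pairs of
  names treats the two positions of the singular crossing together.\<close>

locale added_circle =
  fixes S D :: diagram and c c' u s n :: nat and h :: dir and f :: "nat \<Rightarrow> nat" and C :: "nat set"
  assumes S: "link_diagram S" and D: "link_diagram D"
    and c: "c \<in> crossings S" "c' \<in> crossings S"
    and circle: "tgt S (c, h) = src S (c', opp h)" "tgt S (c', opp h) = src S (c, h)"
    and strand: "tgt S (c, opp h) = src S (c', h)"
    and u: "u \<notin> arcs D" and er: "erases S {c, c'} (add_unknot D u) f"
    and fu: "f (tgt S (c, h)) = u" and fe: "f (tgt S (c, opp h)) \<in> C"
    and C: "C \<in> components D"
    and sn: "{s, n} = {c, c'}" and kinds: "kind S s = Sing" "kind S n = Neg"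
begin

lemma Sg: "arc_graph S" and Dg: "arc_graph D"
  using S D by (simp_all add: arc_graph_if_link_diagram)

lemma cc': "c \<noteq> c'" "c' \<noteq> c" and s_or: "s = c \<and> n = c' \<or> s = c' \<and> n = c" and s_neq_n: "s \<noteq> n"
  and s: "s \<in> crossings S" and n: "n \<in> crossings S"
  using sn kinds c by (auto simp: doubleton_eq_iff)

text \<open>The circle consists of \<open>al\<close> and \<open>be\<close>; the strand enters it along \<open>inc\<close>, runs inside along
  \<open>ga\<close> and leaves along \<open>out\<close>.  If \<open>C\<close> has no other crossings, then \<open>inc\<close> and \<open>out\<close> coincide.\<close>

definition "al = tgt S (c, h)"
definition "be = tgt S (c', opp h)"
definition "ga = tgt S (c, opp h)"
definition "inc = src S (c, opp h)"
definition "out = tgt S (c', h)"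
definition "e = f ga"

lemma ends:
  "src S (c, h) = be" "src S (c, opp h) = inc" "src S (c', opp h) = al" "src S (c', h) = ga"
  "tgt S (c, h) = al" "tgt S (c, opp h) = ga" "tgt S (c', opp h) = be" "tgt S (c', h) = out"
  using circle strand by (simp_all add: al_def be_def ga_def inc_def out_def)

lemma distinct: "al \<noteq> be" "al \<noteq> ga" "be \<noteq> ga" "out \<noteq> al" "out \<noteq> be" "out \<noteq> ga"
  "inc \<noteq> al" "inc \<noteq> be" "inc \<noteq> ga"
  using tgt_eq_iff[OF Sg c(1) c(2), of h "opp h"] tgt_eq_iff[OF Sg c(1) c(1), of h "opp h"]
    tgt_eq_iff[OF Sg c(2) c(1), of "opp h" "opp h"] tgt_eq_iff[OF Sg c(2) c(1), of h h]
    tgt_eq_iff[OF Sg c(2) c(2), of h "opp h"] tgt_eq_iff[OF Sg c(2) c(1), of h "opp h"]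
    src_eq_iff[OF Sg c(1) c(2), of "opp h" "opp h"] src_eq_iff[OF Sg c(1) c(1), of "opp h" h]
    src_eq_iff[OF Sg c(1) c(2), of "opp h" h] cc'
  unfolding ends by simp_all

lemma arcs_S: "al \<in> arcs S" "be \<in> arcs S" "ga \<in> arcs S" "inc \<in> arcs S" "out \<in> arcs S"
  using src_in_arcs[OF Sg c(1)] tgt_in_arcs[OF Sg c(1)] tgt_in_arcs[OF Sg c(2)]
  by (simp_all add: al_def be_def ga_def inc_def out_def)

lemmas erD = resolvesD[OF er[unfolded erases_def], unfolded add_unknot_simps]

lemma erased_strands:
  "{(src S (d, k), tgt S (d, k)) | d k. d \<in> {c, c'}} = {(be, al), (al, be), (inc, ga), (ga, out)}"
  (is "?L = ?R")
proof -
  have "?L = {(src S (d, k), tgt S (d, k)) | d k. d \<in> {c, c'} \<and> k \<in> {h, opp h}}"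
    by (simp flip: UNIV_dir)
  also have "\<dots> = ?R"
    by (auto simp: ends) (metis ends)+
  finally show ?thesis .
qed

lemma f_circle: "f al = u" "f be = u" and f_strand: "f ga = e" "f inc = e" "f out = e"
proof -
  have st: "f x = f y" if "(x, y) \<in> {(be, al), (al, be), (inc, ga), (ga, out)}" for x y
    using erD(6)[unfolded erased_strands] conn_base[OF that] that arcs_S by auto
  show "f al = u" using fu by (simp add: al_def)
  then show "f be = u" using st[of al be] by simp
  show "f ga = e" by (simp add: e_def)
  then show "f inc = e" "f out = e" using st[of inc ga] st[of ga out] by simp_all
qed

lemma e_in_C: "e \<in> C" using fe by (simp add: e_def ga_def)

lemma e_arc: "e \<in> arcs D" and e_neq_u: "e \<noteq> u"
  using e_in_C component_subset[OF Dg C] u by auto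

lemma f_fibre:
  assumes "x \<in> arcs S" "y \<in> arcs S" "f x = f y"
  shows "x = y \<or> {x, y} \<subseteq> {al, be} \<or> {x, y} \<subseteq> {inc, ga, out}"
proof -
  let ?R = "{(be, al), (al, be), (inc, ga), (ga, out)}"
  let ?five = "{al, be, inc, ga, out}"
  \<comment> \<open>\<open>None\<close> labels the five arcs that take part in the gluing, and any
    other arc is its own label, so it can be identified only with itself.\<close>
  let ?k = "\<lambda>x. if x \<in> ?five then None else Some x"
  have xy: "(x, y) \<in> conn ?R"
    using assms erD(6) unfolding erased_strands by simp
  have R: "(a \<in> {al, be} \<longleftrightarrow> b \<in> {al, be}) \<and> (a \<in> {inc, ga, out} \<longleftrightarrow> b \<in> {inc, ga, out}) \<and> ?k a = ?k b"
    if "(a, b) \<in> ?R" for a b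
  proof -
    from that consider "a = be" "b = al" | "a = al" "b = be" | "a = inc" "b = ga" | "a = ga" "b = out"
      by blast
    then show ?thesis by cases (simp_all add: distinct distinct[symmetric])
  qed
  have "x \<in> {al, be} \<longleftrightarrow> y \<in> {al, be}"
    by (rule conn_invariant[OF xy, where k = "\<lambda>x. x \<in> {al, be}"]) (use R in blast)
  moreover have "x \<in> {inc, ga, out} \<longleftrightarrow> y \<in> {inc, ga, out}"
    by (rule conn_invariant[OF xy, where k = "\<lambda>x. x \<in> {inc, ga, out}"]) (use R in blast)
  moreover have "?k x = ?k y"
    by (rule conn_invariant[OF xy, where k = ?k]) (use R in blast)
  moreover have "a \<in> ?five \<longleftrightarrow> a \<in> {al, be} \<or> a \<in> {inc, ga, out}" for a by blast
  ultimately show ?thesis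
    by (cases "x \<in> {al, be}"; cases "x \<in> {inc, ga, out}") simp_all
qed

section \<open>Smoothing the singular crossing: the link with a kink\<close>

definition "q = reroute S s"
definition "K = smooth S s"

lemma noloop: "src S (s, k) \<noteq> tgt S (s, l)"
  using s_or dir_eq_opp[of k h] dir_eq_opp[of l h] distinct by (metis ends)

lemma smoothing_K: "smoothing S s K q"
  unfolding K_def q_def by (rule smoothing_smooth[OF Sg s noloop])

lemma K_graph: "arc_graph K"
  unfolding K_def by (rule arc_graph_smooth[OF Sg s noloop])

text \<open>The alternative for \<open>q out\<close> comes from the case \<open>inc = out\<close>,
  in which \<open>out\<close> itself enters the smoothed crossing \<open>c\<close>.\<close>

lemma q_cases:
  "s = c \<and> n = c' \<and> q be = ga \<and> q inc = al \<and> q al = al \<and> q ga = ga \<and> (q out = al \<or> q out = out) \<or>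
   s = c' \<and> n = c \<and> q al = out \<and> q ga = be \<and> q be = be \<and> q inc = inc \<and> q out = out"
proof -
  have R: "q (src S (s, k)) = tgt S (s, opp k)" for k
    unfolding q_def by (rule reroute_src[OF Sg s noloop])
  have O: "q x = x" if "x \<noteq> src S (s, h)" "x \<noteq> src S (s, opp h)" for x
    unfolding q_def using that dir_eq_opp[of _ h] by (intro reroute_other) metis
  from s_or show ?thesis
  proof
    assume sc: "s = c \<and> n = c'"
    then have "q be = ga" "q inc = al" using R[of h] R[of "opp h"] by (simp_all add: ends)
    moreover have "q x = x" if "x \<noteq> be" "x \<noteq> inc" for x using O[of x] that sc by (simp add: ends)
    ultimately have "q al = al" "q ga = ga" "q out = al \<or> q out = out"
      using distinct \<open>q inc = al\<close> by metis+
    with \<open>q be = ga\<close> \<open>q inc = al\<close> sc show ?thesis by simp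
  next
    assume sc: "s = c' \<and> n = c"
    then have "q al = out" "q ga = be" using R[of h] R[of "opp h"] by (simp_all add: ends)
    moreover have "q x = x" if "x \<noteq> al" "x \<noteq> ga" for x using O[of x] that sc by (simp add: ends)
    ultimately have "q be = be" "q inc = inc" "q out = out"
      using distinct by simp_all
    with \<open>q al = out\<close> \<open>q ga = be\<close> sc show ?thesis by simp
  qed
qed

text \<open>Both positions of the singular crossing lead to the same picture: the strand enters
  \<open>n\<close> along \<open>q inc\<close>, runs around the loop \<open>q be\<close> and leaves
  along \<open>q out\<close>.\<close>

lemma K_ends: "src K (n, h) = q be" "tgt K (n, opp h) = q be" "src K (n, opp h) = q inc" "tgt K (n, h) = q out"
  and q_al: "q al = q inc \<or> q al = q out" and q_ga: "q ga = q be"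
  and loop_neq: "q be \<noteq> q inc" "q be \<noteq> q out" "q inc \<noteq> q be" "q out \<noteq> q be"
proof -
  have Kn: "src K p = q (src S p)" "tgt K p = q (tgt S p)" for p
    by (simp_all add: K_def q_def)
  have "src K (n, h) = q be \<and> tgt K (n, opp h) = q be \<and> src K (n, opp h) = q inc \<and> tgt K (n, h) = q out \<and>
    (q al = q inc \<or> q al = q out) \<and> q ga = q be \<and> q be \<noteq> q inc \<and> q be \<noteq> q out" (is ?P)
  proof -
    from q_cases consider
      (1) "n = c'" "q be = ga" "q inc = al" "q al = al" "q ga = ga" "q out = al \<or> q out = out"
    | (2) "n = c" "q al = out" "q ga = be" "q be = be" "q inc = inc" "q out = out"
      by blast
    then show ?P
    proof cases
      case 1
      have "src S (n, h) = ga" "tgt S (n, opp h) = be" "src S (n, opp h) = al" "tgt S (n, h) = out"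
        using 1(1) ends by simp_all
      with 1(2-) distinct show ?thesis unfolding Kn by metis
    next
      case 2
      have "src S (n, h) = be" "tgt S (n, opp h) = ga" "src S (n, opp h) = inc" "tgt S (n, h) = al"
        using 2(1) ends by simp_all
      with 2(2-) distinct show ?thesis unfolding Kn by metis
    qed
  qed
  then show "src K (n, h) = q be" "tgt K (n, opp h) = q be" "src K (n, opp h) = q inc" "tgt K (n, h) = q out"
    "q al = q inc \<or> q al = q out" "q ga = q be"
    "q be \<noteq> q inc" "q be \<noteq> q out" "q inc \<noteq> q be" "q out \<noteq> q be"
    by (simp_all add: eq_commute[of "q be"])
qed

lemma q_image: "q ` arcs S = arcs K"
  unfolding K_def q_def by (simp add: reroute_image[OF Sg s noloop])

lemma q_fixed: "x \<in> arcs K \<Longrightarrow> q x = x"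
  unfolding K_def q_def by (intro reroute_other) auto

lemma K_arcs: "q be \<in> arcs K" "q inc \<in> arcs K" "q out \<in> arcs K"
  using arcs_S q_image by auto

lemma K_subset: "arcs K \<subseteq> arcs S"
  by (auto simp: K_def)

lemma K_crossings: "crossings K = crossings S - {s}" "n \<in> crossings K" and K_kind: "kind K = kind S"
  using n s_neq_n by (auto simp: K_def)

text \<open>In \<open>K\<close> the circle has become a part of the strand, so the arcs that
  \<open>f\<close> sends to \<open>u\<close> now belong to \<open>e\<close>.\<close>

definition "g x = (if f x = u then e else f x)"

lemma g_values: "x \<in> {al, be, ga, inc, out} \<Longrightarrow> g x = e"
  by (auto simp: g_def f_circle f_strand)

lemma g_q: "g (q x) = g x"
proof -
  consider k where "x = src S (s, k)" | "q x = x"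
    unfolding q_def using reroute_other by metis
  then show ?thesis
  proof cases
    case 1
    then have "q x = tgt S (s, opp k)" unfolding q_def by (simp add: reroute_src[OF Sg s noloop])
    moreover have "x \<in> {al, be, ga, inc, out}" "tgt S (s, opp k) \<in> {al, be, ga, inc, out}"
      using 1 s_or dir_eq_opp[of k h] by (auto simp: ends)
    ultimately show ?thesis using g_values by simp
  qed simp
qed

lemma g_image: "g ` arcs S = arcs D"
proof (intro equalityI subsetI)
  fix y assume "y \<in> g ` arcs S"
  then obtain x where x: "x \<in> arcs S" "y = g x" by blast
  then have "f x \<in> insert u (arcs D)" using erD(1) by blast
  then show "y \<in> arcs D" using x e_arc by (auto simp: g_def)
next
  fix y assume y: "y \<in> arcs D"
  then have "y \<in> f ` arcs S" by (simp add: erD(1))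
  then obtain x where "y = f x" "x \<in> arcs S" by (rule imageE)
  then show "y \<in> g ` arcs S" using y u by (intro image_eqI[of _ _ x]) (auto simp: g_def)
qed

lemma g_fibre:
  assumes "x \<in> arcs S" "y \<in> arcs S" "g x = g y"
  shows "x = y \<or> {x, y} \<subseteq> {al, be, ga, inc, out}"
proof -
  have u': "z \<in> {al, be}" if "z \<in> arcs S" "f z = u" for z
    using f_fibre[OF that(1) arcs_S(1)] that(2) f_circle e_neq_u f_strand by auto
  have e': "z \<in> {inc, ga, out}" if "z \<in> arcs S" "f z = e" for z
    using f_fibre[OF that(1) arcs_S(3)] that(2) f_circle e_neq_u f_strand distinct by auto
  show ?thesis
    using assms u'[of x] u'[of y] e'[of x] e'[of y] f_fibre[OF assms(1,2)]
    by (auto simp: g_def split: if_splits)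
qed

lemma g_fibre_K:
  assumes "x \<in> arcs K" "y \<in> arcs K" "g x = g y"
  shows "x = y \<or> {x, y} \<subseteq> {q be, q inc, q out}"
proof -
  have "x = y \<or> {q x, q y} \<subseteq> q ` {al, be, ga, inc, out}"
    using g_fibre[of x y] assms K_subset by blast
  moreover have "q ` {al, be, ga, inc, out} \<subseteq> {q be, q inc, q out}"
    using q_al q_ga by auto
  ultimately show ?thesis
    using q_fixed[OF assms(1)] q_fixed[OF assms(2)] by auto
qed

lemma D_crossings: "crossings D = crossings K - {n}"
  using erD(2) s_or by (auto simp: K_crossings)

lemma D_ends:
  assumes "d \<in> crossings D"
  shows "src D (d, k) = g (src K (d, k))" "tgt D (d, k) = g (tgt K (d, k))" "kind D d = kind K d"
proof -
  have "g (src K (d, k)) = g (src S (d, k))" "g (tgt K (d, k)) = g (tgt S (d, k))"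
    unfolding K_def smooth_simps q_def[symmetric] by (rule g_q)+
  moreover have "f (src S (d, k)) \<noteq> u" "f (tgt S (d, k)) \<noteq> u"
    using erD(4,5)[OF assms, of k] src_in_arcs[OF Dg assms, of k] tgt_in_arcs[OF Dg assms, of k] u
    by auto
  ultimately show "src D (d, k) = g (src K (d, k))" "tgt D (d, k) = g (tgt K (d, k))"
    using erD(4,5)[OF assms, of k] by (simp_all add: g_def)
  show "kind D d = kind K d" using erD(3)[OF assms] by (simp add: K_kind)
qed

lemma gK_image: "g ` arcs K = arcs D"
  using g_image g_q unfolding q_image[symmetric] image_image by simp

text \<open>Straightening the kink gives back \<open>D\<close>: the arcs of \<open>K\<close> that
  \<open>g\<close> sends to \<open>e\<close> are those on the strand through \<open>n\<close>, and
  elsewhere \<open>g\<close> is injective.\<close>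

lemma erases_K: "erases K {n} D g"
proof -
  let ?G = "{(src K (d, k), tgt K (d, k)) | d k. d \<in> {n}}"
  have "?G = {(src K (n, k), tgt K (n, k)) | k. k \<in> {h, opp h}}"
    by (simp flip: UNIV_dir)
  then have G: "?G = {(q be, q out), (q inc, q be)}"
    by (auto simp: K_ends) (metis K_ends)+
  have "g x = g y \<longleftrightarrow> (x, y) \<in> conn ?G" if xy: "x \<in> arcs K" "y \<in> arcs K" for x y
  proof
    assume "g x = g y"
    from g_fibre_K[OF xy this] show "(x, y) \<in> conn ?G"
    proof
      have b: "(q be, z) \<in> conn ?G" if "z \<in> {q be, q inc, q out}" for z
        using that unfolding G by (auto intro: conn_base conn_sym[OF conn_base])
      assume "{x, y} \<subseteq> {q be, q inc, q out}"
      then show ?thesis using conn_trans[OF conn_sym[OF b[of x]] b[of y]] by simp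
    qed simp
  next
    assume "(x, y) \<in> conn ?G"
    then show "g x = g y"
      unfolding G by (rule conn_invariant) (auto simp: g_q g_values)
  qed
  then show ?thesis
    unfolding erases_def resolves_def conn_def using gK_image D_crossings D_ends by simp
qed

text \<open>The loop \<open>q be\<close> leaves \<open>n\<close> on the strand \<open>opp h\<close>
  and returns on \<open>h\<close>, hence the instance \<open>opp h\<close>.\<close>

lemma link_diagram_K: "link_diagram K"
  by (rule link_diagram_kink[OF K_graph K_crossings(2) _ erases_K D, of "opp h"]) (simp add: K_ends)

text \<open>The kind of \<open>n\<close> is left open because rule III' at the kink compares its two
  signs; with \<open>Neg\<close> the diagram is \<open>K\<close> itself.\<close>

lemma move_K:
  assumes "k \<noteq> Sing"
  shows "move (set_kind K n k) D g"
proof -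
  have "move1 (set_kind K n k) D g"
    unfolding move1_def using assms K_crossings erases_K
    by (intro bexI[of _ n] exI[of _ "opp h"]) (simp_all add: K_ends erases_set_kind)
  then show ?thesis using link_diagram_K D by (simp add: move_def)
qed

lemma K_Neg: "set_kind K n Neg = K"
proof -
  have "(kind K)(n := Neg) = kind K" using kinds(2) by (simp add: K_kind fun_upd_idem)
  then show ?thesis by (simp add: set_kind_def)
qed

section \<open>Smoothing the kink: the link with a split circle\<close>

definition "g' x = (if x = q be then u else g x)"

text \<open>At the kink the loop closes up and becomes the circle \<open>u\<close>, while the strand
  goes on from \<open>q inc\<close> to \<open>q out\<close>; so \<open>g'\<close> departs from
  \<open>g\<close> on the loop only.\<close>

lemma smoothing_unknot: "smoothing K n (add_unknot D u) g'"
proof -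
  let ?G = "{(src K (n, k), tgt K (n, opp k)) | k. True}"
  have "?G = {(src K (n, k), tgt K (n, opp k)) | k. k \<in> {h, opp h}}"
    by (simp flip: UNIV_dir)
  then have G: "?G = {(q be, q be), (q inc, q out)}"
    by (auto simp: K_ends) (metis K_ends opp_simps(1))+
  have gu: "g x \<noteq> u" if "x \<in> arcs K" for x
    using imageI[OF that, of g] u by (auto simp: gK_image)
  have "g' x = g' y \<longleftrightarrow> (x, y) \<in> conn ?G" if xy: "x \<in> arcs K" "y \<in> arcs K" for x y
  proof
    assume eq: "g' x = g' y"
    show "(x, y) \<in> conn ?G"
    proof (cases "x = q be \<or> y = q be")
      case True
      then have "x = y" using eq gu[OF xy(1)] gu[OF xy(2)] by (auto simp: g'_def split: if_splits)
      then show ?thesis by simp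
    next
      case False
      then have "g x = g y" using eq by (simp add: g'_def)
      with False g_fibre_K[OF xy] have "x = y \<or> {x, y} \<subseteq> {q inc, q out}" by auto
      then show ?thesis
        unfolding G by (auto intro: conn_base conn_sym[OF conn_base])
    qed
  next
    assume "(x, y) \<in> conn ?G"
    then show "g' x = g' y"
      unfolding G by (rule conn_invariant) (auto simp: g'_def g_q g_values loop_neq)
  qed
  moreover have "g' ` arcs K = insert u (arcs D)"
  proof (intro equalityI subsetI)
    fix y assume "y \<in> insert u (arcs D)"
    then have "y = u \<or> y \<in> g ` arcs K" by (simp add: gK_image)
    then consider "y = u" | x where "x \<in> arcs K" "y = g x" by (elim disjE imageE)
    then show "y \<in> g' ` arcs K"
    proof cases
      case 1
      then show ?thesis using K_arcs(1) by (auto simp: g'_def)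
    next
      case 2
      show ?thesis
      proof (cases "x = q be")
        case True
        then have "y = g' (q inc)" using 2 loop_neq by (simp add: g'_def g_q g_values)
        then show ?thesis using K_arcs by blast
      next
        case False
        then show ?thesis using 2 by (auto simp: g'_def)
      qed
    qed
  qed (use gK_image in \<open>auto simp: g'_def\<close>)
  moreover have "src K (d, k) \<noteq> q be" "tgt K (d, k) \<noteq> q be" if "d \<in> crossings D" for d k
    using that src_eq_iff[OF K_graph _ K_crossings(2), of d k h]
      tgt_eq_iff[OF K_graph _ K_crossings(2), of d k "opp h"]
    by (auto simp: D_crossings K_ends)
  ultimately show ?thesis
    unfolding smoothing_def resolves_def conn_def using D_crossings D_ends by (simp add: g'_def)
qed

text \<open>The circle tied to \<open>C\<close>. This partition is reached in two ways, from the
  positive resolution of \<open>S\<close> after the merger at \<open>s\<close> and from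
  \<open>K\<close> by smoothing the kink; therefore rule III' at the kink evaluates the tied
  circle.\<close>

definition "merged = insert {{u}, C} ((\<lambda>X. {X}) ` (components D - {C}))"

lemmas components_unknot = components_add_unknot[OF Dg u]

text \<open>Only one component \<open>X\<close> of \<open>K\<close> passes through \<open>n\<close>,
  so the merger leaves the singletons as they are. The smoothing splits \<open>X\<close> into
  \<open>C\<close> and the circle, which remain together in the block inherited from
  \<open>X\<close>.\<close>

lemma carry_unknot: "carry g' (add_unknot D u) (merge K n (singletons K)) = merged"
proof -
  have bij: "bij_betw ((`) g) (components K) (components D)"
    using erases_components[OF K_graph _ erases_K] K_crossings(2) by simp
  obtain X where X: "X \<in> components K" "q be \<in> X"
    using component_of[OF K_arcs(1)] .
  have "(q inc, q be) \<in> conn (strands K)"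
    unfolding strands_def using K_crossings(2) K_ends by (intro conn_base) (metis (mono_tags, lifting) mem_Collect_eq)
  then have "q inc \<in> X"
    using in_class[of X "arcs K" "strands K" "q be"] X by (simp add: components_eq conn_sym)
  then have "merge K n (singletons K) = insert {X, X} ((\<lambda>C. {C}) ` (components K - {X, X}))"
    using X by (intro merge_singletons[of _ _ _ _ h]) (simp_all add: K_ends)
  then have J: "merge K n (singletons K) = insert {X} ((\<lambda>C. {C}) ` (components K - {X}))"
    by simp
  have gX: "g ` X = C"
  proof -
    have "e \<in> g ` X" using X(2) g_values[of be] g_q[of be] by force
    moreover have "g ` X \<in> components D" using bij X(1) bij_betwE by blast
    ultimately show ?thesis using components_disjoint[OF _ C _ e_in_C] by blast
  qed
  have g'X: "g' ` X = insert u C"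
  proof -
    have "g' ` X = insert u (g ` X)"
    proof (intro equalityI subsetI)
      fix y assume "y \<in> insert u (g ` X)"
      then consider "y = u" | "y = e" | x where "x \<in> X" "x \<noteq> q be" "y = g x"
        using g_values[of be] g_q[of be] by force
      then show "y \<in> g' ` X"
      proof cases
        case 1
        then show ?thesis using X(2) by (auto simp: g'_def)
      next
        case 2
        then have "y = g' (q inc)" using loop_neq by (simp add: g'_def g_q g_values)
        then show ?thesis using \<open>q inc \<in> X\<close> by blast
      next
        case 3
        then show ?thesis by (auto simp: g'_def)
      qed
    qed (auto simp: g'_def)
    then show ?thesis by (simp add: gX)
  qed
  have g'Y: "g' ` Y = g ` Y" if "Y \<in> components K - {X}" for Y
  proof -
    have "q be \<notin> Y" using that X components_disjoint by blast
    then show ?thesis by (intro image_cong) (auto simp: g'_def)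
  qed
  have uC: "u \<notin> Y" if "Y \<in> components D" for Y
    using component_subset[OF Dg that] u by blast
  have sub: "{Z \<in> insert {u} (components D). Z \<subseteq> Y} = {Y}" if "Y \<in> components D" for Y
    using that uC component_subset_imp_eq[of _ D Y] by auto
  have subC: "{Z \<in> insert {u} (components D). Z \<subseteq> insert u C} = {{u}, C}"
    using C uC component_subset_imp_eq[of _ D C] by auto
  have "carry g' (add_unknot D u) (merge K n (singletons K)) =
    insert {Z \<in> insert {u} (components D). Z \<subseteq> g' ` X}
      ((\<lambda>Y. {Z \<in> insert {u} (components D). Z \<subseteq> g' ` Y}) ` (components K - {X}))"
    unfolding carry_def J components_unknot(1) by (simp add: image_image)
  also have "(\<lambda>Y. {Z \<in> insert {u} (components D). Z \<subseteq> g' ` Y}) ` (components K - {X}) =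
      (\<lambda>Y. {g ` Y}) ` (components K - {X})"
  proof (rule image_cong[OF refl])
    fix Y assume Y: "Y \<in> components K - {X}"
    then have "g ` Y \<in> components D" using bij bij_betwE by blast
    then show "{Z \<in> insert {u} (components D). Z \<subseteq> g' ` Y} = {g ` Y}"
      unfolding g'Y[OF Y] by (rule sub)
  qed
  also have "\<dots> = (\<lambda>Y. {Y}) ` ((`) g ` components K - {g ` X})"
    using inj_on_image_set_diff[OF bij_betw_imp_inj_on[OF bij], of "components K" "{X}"] X(1)
    by (simp add: image_image[symmetric, of "\<lambda>Y. {Y}" "(`) g"])
  finally show ?thesis
    unfolding g'X subC gX bij_betw_imp_surj_on[OF bij] by (simp add: merged_def)
qed

section \<open>The positive resolution: removing the circle by a second move\<close>

lemma bigon: "bigon S c c'" "bigon S c' c"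
proof -
  \<comment> \<open>The bigon lies between \<open>ga\<close> and \<open>al\<close>, which both run
    from \<open>c\<close> to \<open>c'\<close>. The north sector of \<open>c\<close> and the south
    sector of \<open>c'\<close> relate the same two sides, and no other corner involves
    them.\<close>
  define z where "z = (if h = Rightward then Rgt else Lft)"
  define z' where "z' = (if h = Rightward then Lft else Rgt)"
  define A where "A = al"
  define G where "G = ga"
  have AG: "tgt S (c, h) = A" "tgt S (c, opp h) = G" "src S (c', opp h) = A" "src S (c', h) = G" "A \<noteq> G"
    using ends distinct(2) by (simp_all add: A_def G_def)
  let ?F = "{(G, z), (A, z')}"
  have "((G, z), (A, z')) \<in> corners S \<or> ((A, z'), (G, z)) \<in> corners S"
    unfolding corners_def using c(1) AG by (cases h) (auto simp: z_def z'_def)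
  then have mem: "((G, z), (A, z')) \<in> conn (corners S)"
    by (auto intro: conn_base conn_sym[OF conn_base])
  have closed: "p \<in> ?F \<longleftrightarrow> p' \<in> ?F" if p: "(p, p') \<in> corners S" for p p'
  proof -
    from p obtain d where d: "d \<in> crossings S"
      "(p, p') \<in> {((tgt S (d, Leftward), Rgt), (tgt S (d, Rightward), Lft)),
      ((tgt S (d, Rightward), Rgt), (src S (d, Leftward), Rgt)),
      ((src S (d, Rightward), Rgt), (src S (d, Leftward), Lft)),
      ((tgt S (d, Leftward), Lft), (src S (d, Rightward), Lft))}"
      unfolding corners_def by blast
    have inj: "tgt S (d, k) = A \<longleftrightarrow> d = c \<and> k = h" "tgt S (d, k) = G \<longleftrightarrow> d = c \<and> k = opp h"
      "src S (d, k) = A \<longleftrightarrow> d = c' \<and> k = opp h" "src S (d, k) = G \<longleftrightarrow> d = c' \<and> k = h" for k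
      using tgt_eq_iff[OF Sg d(1) c(1), of k h] tgt_eq_iff[OF Sg d(1) c(1), of k "opp h"]
        src_eq_iff[OF Sg d(1) c(2), of k h] src_eq_iff[OF Sg d(1) c(2), of k "opp h"]
      by (simp_all add: AG)
    show ?thesis
      using d(2) inj by (cases h) (auto simp: z_def z'_def)
  qed
  have "conn (corners S) `` {(G, z)} = ?F"
  proof (intro equalityI subsetI)
    fix p assume "p \<in> conn (corners S) `` {(G, z)}"
    then have "((G, z), p) \<in> conn (corners S)" by simp
    then have "(G, z) \<in> ?F \<longleftrightarrow> p \<in> ?F"
      by (rule conn_invariant[where k = "\<lambda>p. p \<in> ?F"]) (rule closed)
    then show "p \<in> ?F" by simp
  qed (use mem in auto)
  then have "{(ga, z), (al, z')} \<in> faces S"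
    unfolding faces_def using class_in_classes[of "(G, z)" "arcs S \<times> UNIV" "corners S"] arcs_S
    by (simp add: A_def G_def)
  moreover have "joins S ga c c'" "joins S al c c'" "joins S ga c' c" "joins S al c' c"
    unfolding joins_def using ends by metis+
  ultimately show "bigon S c c'" "bigon S c' c"
    unfolding bigon_def using c cc' distinct(2)[symmetric] by blast+
qed

text \<open>\<open>move2\<close> names the positive crossing first, and \<open>s\<close> may be
  \<open>c\<close> or \<open>c'\<close>; this is why the bigon is given in both orders.\<close>

lemma move_Pos: "move (set_kind S s Pos) (add_unknot D u) f"
proof -
  have "erases S {s, n} (add_unknot D u) f" using er sn by simp
  then have "move2 (set_kind S s Pos) (add_unknot D u) f"
    unfolding move2_def using bigon s_or kinds s_neq_n
    by (intro exI[of _ s] exI[of _ n]) (auto simp: erases_set_kind)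
  then show ?thesis
    using S link_diagram_add_unknot[OF D u] by (simp add: move_def)
qed

lemma bij_Pos: "bij_betw ((`) f) (components S) (insert {u} (components D))"
  using move_components[OF move_Pos] by (simp add: components_unknot)

lemma card_components: "card (components S) = Suc (card (components D))"
  using bij_betw_same_card[OF bij_Pos] components_unknot(2) finite_components[OF Dg] by simp

text \<open>Of the two arcs entering \<open>s\<close>, one lies on the circle and the other on the
  strand, so the united block consists of the components that \<open>f\<close> carries to
  \<open>{u}\<close> and to \<open>C\<close>.\<close>

lemma merged_Pos:
  "cts_diagram S (merge S s (singletons S))"
  "(`) ((`) f) ` merge S s (singletons S) = merged"
proof -
  obtain Ca where Ca: "Ca \<in> components S" "src S (s, h) \<in> Ca"
    using component_of[OF src_in_arcs[OF Sg s]] .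
  obtain Cb where Cb: "Cb \<in> components S" "src S (s, opp h) \<in> Cb"
    using component_of[OF src_in_arcs[OF Sg s]] .
  show "cts_diagram S (merge S s (singletons S))"
    using partition_merge_singletons[of Ca S Cb s h] Ca Cb S by (simp add: cts_diagram_def)
  have J: "merge S s (singletons S) = insert {Ca, Cb} ((\<lambda>C. {C}) ` (components S - {Ca, Cb}))"
    using Ca Cb by (intro merge_singletons)
  have im: "f ` Ca \<in> insert {u} (components D)" "f ` Cb \<in> insert {u} (components D)"
    using bij_betwE[OF bij_Pos] Ca Cb by blast+
  have uD: "u \<notin> Y" if "Y \<in> components D" for Y
    using component_subset[OF Dg that] u by blast
  have is_u: "Y = {u}" if "Y \<in> insert {u} (components D)" "u \<in> Y" for Y
    using that uD by blast
  have is_C: "Y = C" if "Y \<in> insert {u} (components D)" "e \<in> Y" for Y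
    using that e_neq_u components_disjoint[OF _ C _ e_in_C] by blast
  have "f (src S (s, h)) = u \<and> f (src S (s, opp h)) = e \<or> f (src S (s, h)) = e \<and> f (src S (s, opp h)) = u"
    using s_or f_circle f_strand ends by auto
  then have CC: "{f ` Ca, f ` Cb} = {{u}, C}"
  proof
    assume "f (src S (s, h)) = u \<and> f (src S (s, opp h)) = e"
    then have "f ` Ca = {u}" "f ` Cb = C"
      using is_u[OF im(1)] is_C[OF im(2)] Ca(2) Cb(2) by (metis imageI)+
    then show ?thesis by simp
  next
    assume "f (src S (s, h)) = e \<and> f (src S (s, opp h)) = u"
    then have "f ` Ca = C" "f ` Cb = {u}"
      using is_C[OF im(1)] is_u[OF im(2)] Ca(2) Cb(2) by (metis imageI)+
    then show ?thesis by auto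
  qed
  have "(`) f ` (components S - {Ca, Cb}) = insert {u} (components D) - {{u}, C}"
    using inj_on_image_set_diff[OF bij_betw_imp_inj_on[OF bij_Pos], of "components S" "{Ca, Cb}"]
      Ca(1) Cb(1) CC bij_betw_imp_surj_on[OF bij_Pos] by simp
  also have "\<dots> = components D - {C}" using components_unknot(2) by auto
  finally have "(\<lambda>X. {f ` X}) ` (components S - {Ca, Cb}) = (\<lambda>X. {X}) ` (components D - {C})"
    by (simp add: image_image[symmetric, of "\<lambda>Y. {Y}" "(`) f"])
  then show "(`) ((`) f) ` merge S s (singletons S) = merged"
    unfolding J merged_def by (simp add: image_image CC)
qed

text \<open>Both arcs entering \<open>s\<close> end up on the strand through the kink, so the
  smoothing fuses the circle with the component to which it is tied.\<close>

lemma carry_K: "carry q K (merge S s (singletons S)) = singletons K"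
proof (rule carry_smoothing_singletons[OF Sg s smoothing_K])
  have "(q inc, q be) \<in> conn (strands K)" "(q be, q out) \<in> conn (strands K)"
    using K_crossings(2) by (auto intro!: conn_base simp: strands_def) (metis K_ends)+
  then have b: "(q be, z) \<in> conn (strands K)" if "z \<in> {q be, q inc, q out}" for z
    using that conn_sym by auto
  have "q (src S (s, k)) \<in> {q be, q inc, q out}" for k
    using s_or dir_eq_opp[of k h] q_al q_ga by (auto simp: ends)
  then show "(q (src S (s, Rightward)), q (src S (s, Leftward))) \<in> conn (strands K)"
    by (intro conn_trans[OF conn_sym[OF b] b])
qed

end

section \<open>Values of the invariants on the resolutions\<close>

context added_circle
begin

lemma set_kind_Sing: "set_kind S s Sing = S"
proof -
  have "(kind S)(s := Sing) = kind S" using kinds(1) by (simp add: fun_upd_idem)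
  then show ?thesis by (simp add: set_kind_def)
qed

text \<open>These are the values that the rules for a singular crossing ask for: the smoothing, the
  positive resolution with a free circle, as for \<Psi>, and with a tied one, as for \<Phi>. The
  last is kept in the form in which rule III' provides it, without a division.\<close>

lemma tied_values:
  assumes I: "tied_rules (\<lambda>_. True) v a r I"
  shows "I K (carry q K (merge S s (singletons S))) = I D (singletons D)"
    and "I (set_kind S s Pos) (singletons S) = v / (a * r) * I D (singletons D)"
    and "(v - inverse v) * I (set_kind S s Pos) (merge S s (singletons S)) =
      (1 / r - r) * I D (singletons D)"
proof -
  have iso: "I E J = I E' J'" if "cts_diagram E J" "cts_isotopic (E, J) (E', J')" for E J E' J'
    using I that unfolding tied_rules_def by blast
  have K: "I (set_kind K n k) (singletons K) = I D (singletons D)" if "k \<noteq> Sing" for k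
    using iso[OF _ cts_isotopic_singletons_if_move[OF move_K[OF that]]] link_diagram_K by simp
  show "I K (carry q K (merge S s (singletons S))) = I D (singletons D)"
    using K[of Neg] by (simp add: carry_K K_Neg)
  have "singletons (add_unknot D u) = insert {{u}} (singletons D)"
    by (simp add: singletons_def components_unknot)
  then have "I (set_kind S s Pos) (singletons S) = I (add_unknot D u) (insert {{u}} (singletons D))"
    using iso[OF _ cts_isotopic_singletons_if_move[OF move_Pos]] S by simp
  also have "\<dots> = v / (a * r) * I D (singletons D)"
    using I D u unfolding tied_rules_def by simp
  finally show "I (set_kind S s Pos) (singletons S) = v / (a * r) * I D (singletons D)" .
  have "I (set_kind S s Pos) (merge S s (singletons S)) = I (add_unknot D u) merged"
    using iso[OF _ cts_isotopic_if_move[OF move_Pos]] merged_Pos by simp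
  moreover have "1 / r * I (set_kind K n Pos) (singletons K) - r * I (set_kind K n Neg) (singletons K) =
      (v - inverse v) * I (add_unknot D u) (carry g' (add_unknot D u) (merge K n (singletons K)))"
    using I link_diagram_K K_crossings(2) smoothing_unknot
    unfolding tied_rules_def by (meson cts_diagram_singletons)
  ultimately show "(v - inverse v) * I (set_kind S s Pos) (merge S s (singletons S)) =
      (1 / r - r) * I D (singletons D)"
    by (simp add: K carry_unknot left_diff_distrib)
qed

lemma Paris_Rabenda_value:
  assumes P: "Homflypt_rules v r P" and I: "Paris_Rabenda_rules x y P I"
    and cl: "classical D" and v: "v - inverse v \<noteq> 0"
  shows "I S = (x + y * ((1 / r - r) / (v - inverse v))) * P D"
proof -
  have iso: "I E = I E'" if "move E E' f'" for E E' f'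
    using I link_isotopic_if_move[OF that] that unfolding Paris_Rabenda_rules_def move_def by blast
  have IP: "I E = P E" if "link_diagram E" "classical E" for E
    using I that unfolding Paris_Rabenda_rules_def by blast
  have clK: "classical (set_kind K n k)" if "k \<noteq> Sing" for k
    using move_classical[OF move_K[OF that]] cl by simp
  \<comment> \<open>The invariance of \<open>P\<close> under the first move is read off from
    \<open>I\<close>, which agrees with \<open>P\<close> on both classical diagrams.\<close>
  have PK: "P (set_kind K n k) = P D" if "k \<noteq> Sing" for k
    using iso[OF move_K[OF that]] IP clK[OF that] link_diagram_K D cl by simp
  have "1 / r * P (set_kind K n Pos) - r * P (set_kind K n Neg) = (v - inverse v) * P (add_unknot D u)"
    using P link_diagram_K K_crossings(2) clK smoothing_unknot
    unfolding Homflypt_rules_def by (meson kind.distinct)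
  then have "(1 / r - r) * P D = (v - inverse v) * P (add_unknot D u)"
    by (simp add: PK left_diff_distrib)
  then have unknot: "P (add_unknot D u) = (1 / r - r) / (v - inverse v) * P D"
    using v by (simp add: eq_divide_eq mult.commute)
  have "I S = x * I K + y * I (set_kind S s Pos)"
    using I S s smoothing_K set_kind_Sing unfolding Paris_Rabenda_rules_def by metis
  also have "I K = P D"
    using iso[OF move_K[of Neg]] IP D cl by (simp add: K_Neg)
  also have "I (set_kind S s Pos) = P (add_unknot D u)"
    using iso[OF move_Pos] IP link_diagram_add_unknot[OF D u] cl by (simp add: classical_def)
  finally show ?thesis by (simp add: unknot algebra_simps)
qed

end

section \<open>From concrete diagrams to links up to isotopy\<close>

lemma obtained_by_adding_circleE:
  assumes "obtained_by_adding_circle L S" and "link_diagram L"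
  obtains S' D c c' u s n h f C where
    "added_circle S' D c c' u s n h f C" "link_isotopic L D" "link_isotopic S' S"
proof -
  from assms(1) obtain D C S' where iso: "link_isotopic L D" "link_isotopic S' S"
    and C: "C \<in> components D" and add: "adds_circle D C S'"
    unfolding obtained_by_adding_circle_def by blast
  from add obtain c c' h u f where S': "link_diagram S'"
    and *: "c \<in> crossings S'" "c' \<in> crossings S'" "{kind S' c, kind S' c'} = {Sing, Neg}"
      "tgt S' (c, h) = src S' (c', opp h)" "tgt S' (c', opp h) = src S' (c, h)"
      "tgt S' (c, opp h) = src S' (c', h)"
      "u \<notin> arcs D" "erases S' {c, c'} (add_unknot D u) f"
      "f (tgt S' (c, h)) = u" "f (tgt S' (c, opp h)) \<in> C"
    unfolding adds_circle_def by blast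
  obtain s n where "{s, n} = {c, c'}" "kind S' s = Sing" "kind S' n = Neg"
    using *(3) by (metis doubleton_eq_iff)
  then have "added_circle S' D c c' u s n h f C"
    using * S' C link_isotopic_invariants(1)[OF iso(1) assms(2)] by unfold_locales
  then show ?thesis using that iso by blast
qed

context
  fixes L S :: diagram
  assumes LS: "obtained_by_adding_circle L S" and L: "link_diagram L"
begin

lemma card_components_circle: "card (components S) = Suc (card (components L))"
proof -
  obtain S' D c c' u s n h f C where ac: "added_circle S' D c c' u s n h f C"
    and iso: "link_isotopic L D" "link_isotopic S' S"
    using obtained_by_adding_circleE[OF LS L] .
  interpret added_circle S' D c c' u s n h f C by (rule ac)
  show ?thesis
    using card_components link_isotopic_invariants(2)[OF iso(1) L] link_isotopic_invariants(2)[OF iso(2) S]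
    by simp
qed

lemma Phi_circle:
  assumes \<Phi>: "Phi_rules v a r x y \<Phi>" and v: "v - inverse v \<noteq> 0"
  shows "\<Phi> S (singletons S) = (x + y * ((1 / r - r) / (v - inverse v))) * \<Phi> L (singletons L)"
proof -
  obtain S' D c c' u s n h f C where ac: "added_circle S' D c c' u s n h f C"
    and iso: "link_isotopic L D" "link_isotopic S' S"
    using obtained_by_adding_circleE[OF LS L] .
  interpret added_circle S' D c c' u s n h f C by (rule ac)
  have tied: "tied_rules (\<lambda>_. True) v a r \<Phi>" using \<Phi> by (simp add: Phi_rules_def)
  have inv: "\<Phi> E (singletons E) = \<Phi> E' (singletons E')" if "link_isotopic E E'" "link_diagram E" for E E'
    using tied link_isotopic_invariants(4)[OF that] that(2) cts_diagram_singletons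
    unfolding tied_rules_def by metis
  have "\<Phi> S' (singletons S') = x * \<Phi> K (carry q K (merge S' s (singletons S'))) +
      y * \<Phi> (set_kind S' s Pos) (merge S' s (singletons S'))"
    using \<Phi> S s smoothing_K set_kind_Sing cts_diagram_singletons unfolding Phi_rules_def by metis
  moreover have "\<Phi> (set_kind S' s Pos) (merge S' s (singletons S')) =
      (1 / r - r) / (v - inverse v) * \<Phi> D (singletons D)"
    using tied_values(3)[OF tied] v by (simp add: eq_divide_eq mult.commute)
  ultimately show ?thesis
    using tied_values(1)[OF tied] inv[OF iso(1) L] inv[OF iso(2) S] by (simp add: algebra_simps)
qed

lemma Psi_circle:
  assumes \<Psi>: "Psi_rules v a r x y \<Psi>"
  shows "\<Psi> S (singletons S) = (x + y * (v / (a * r))) * \<Psi> L (singletons L)"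
proof -
  obtain S' D c c' u s n h f C where ac: "added_circle S' D c c' u s n h f C"
    and iso: "link_isotopic L D" "link_isotopic S' S"
    using obtained_by_adding_circleE[OF LS L] .
  interpret added_circle S' D c c' u s n h f C by (rule ac)
  have tied: "tied_rules (\<lambda>_. True) v a r \<Psi>" using \<Psi> by (simp add: Psi_rules_def)
  have inv: "\<Psi> E (singletons E) = \<Psi> E' (singletons E')" if "link_isotopic E E'" "link_diagram E" for E E'
    using tied link_isotopic_invariants(4)[OF that] that(2) cts_diagram_singletons
    unfolding tied_rules_def by metis
  have "\<Psi> S' (singletons S') = x * \<Psi> K (carry q K (merge S' s (singletons S'))) +
      y * \<Psi> (set_kind S' s Pos) (singletons S')"
    using \<Psi> S s smoothing_K set_kind_Sing cts_diagram_singletons unfolding Psi_rules_def by metis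
  then show ?thesis
    using tied_values(1,2)[OF tied] inv[OF iso(1) L] inv[OF iso(2) S] by (simp add: algebra_simps)
qed

lemma Paris_Rabenda_circle:
  assumes P: "Homflypt_rules v r P" and I: "Paris_Rabenda_rules x y P I"
    and cl: "classical L" and v: "v - inverse v \<noteq> 0"
  shows "I S = (x + y * ((1 / r - r) / (v - inverse v))) * P L"
proof -
  obtain S' D c c' u s n h f C where ac: "added_circle S' D c c' u s n h f C"
    and iso: "link_isotopic L D" "link_isotopic S' S"
    using obtained_by_adding_circleE[OF LS L] .
  interpret added_circle S' D c c' u s n h f C by (rule ac)
  have "I S' = (x + y * ((1 / r - r) / (v - inverse v))) * P D"
    using link_isotopic_invariants(3)[OF iso(1) L] cl by (intro Paris_Rabenda_value[OF P I _ v]) simp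
  moreover have "P L = P D" using P L cl iso(1) unfolding Homflypt_rules_def by blast
  moreover have "I S' = I S" using I S iso(2) unfolding Paris_Rabenda_rules_def by blast
  ultimately show ?thesis by simp
qed

end

subsection \<open>The coefficients\<close>

lemma field_hom_simps:
  assumes "field_hom \<phi>"
  shows "\<phi> 0 = 0" "\<phi> 1 = 1" "\<phi> (s + t) = \<phi> s + \<phi> t" "\<phi> (s - t) = \<phi> s - \<phi> t" "\<phi> (s * t) = \<phi> s * \<phi> t"
    "\<phi> (s ^ k) = \<phi> s ^ k" "t \<noteq> 0 \<Longrightarrow> \<phi> t \<noteq> 0"
proof -
  show one: "\<phi> 1 = 1" and add: "\<phi> (s + t) = \<phi> s + \<phi> t" and mult: "\<phi> (s * t) = \<phi> s * \<phi> t" for s t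
    using assms by (simp_all add: field_hom_def)
  show "\<phi> 0 = 0" by (metis add add_0_left add_cancel_right_left)
  show "\<phi> (s - t) = \<phi> s - \<phi> t" using add[of "s - t" t] by simp
  show "\<phi> (s ^ k) = \<phi> s ^ k" by (induction k) (simp_all add: one mult)
  show "\<phi> t \<noteq> 0" if "t \<noteq> 0" using that one mult[of t "inverse t"] by auto
qed

text \<open>Pulled inside \<open>to_fract\<close>, each claim concerns nested polynomials and is
  settled by coefficients. In the last two the part free of \<open>y\<close> is
  \<open>x^2 a (a + (1 - v^2) b)\<close>, which the term in \<open>y^2\<close> cannot
  cancel.\<close>

lemma variables_nonzero:
  "var_v \<noteq> 0" "var_a \<noteq> 0" "var_v\<^sup>2 - 1 \<noteq> 0" "var_a + (1 - var_v\<^sup>2) * var_b \<noteq> 0"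
  "var_x\<^sup>2 * var_a * (var_a + (1 - var_v\<^sup>2) * var_b) - var_y\<^sup>2 * var_v\<^sup>2 * var_b\<^sup>2 \<noteq> 0"
  "var_x\<^sup>2 * var_a * (var_a + (1 - var_v\<^sup>2) * var_b) - var_y\<^sup>2 * var_v\<^sup>2 \<noteq> 0"
  unfolding var_v_def var_a_def var_b_def var_x_def var_y_def power2_eq_square to_fract_1[symmetric]
    to_fract_mult[symmetric] to_fract_add[symmetric] to_fract_diff[symmetric] to_fract_eq_0_iff
  by (simp_all add: one_pCons)

text \<open>Only the square of \<open>r\<close> is known. If the factor vanished, then
  \<open>x a r = - y v t\<close>, and squaring removes \<open>r\<close> and leaves the relation that
  \<open>nz\<close> excludes.\<close>

lemma factor_nonzero:
  fixes x y v a b r t :: "'k::field"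
  assumes "a \<noteq> 0" "r \<noteq> 0" "r\<^sup>2 = (a + (1 - v\<^sup>2) * b) / a"
    and nz: "x\<^sup>2 * a * (a + (1 - v\<^sup>2) * b) - y\<^sup>2 * v\<^sup>2 * t\<^sup>2 \<noteq> 0"
  shows "x + y * (v * t / (a * r)) \<noteq> 0"
proof
  assume "x + y * (v * t / (a * r)) = 0"
  then have "x * (a * r) + y * (v * t) = 0"
    using assms(1,2) by (simp add: divide_simps)
  then have "x * (a * r) = - (y * (v * t))" by (simp add: eq_neg_iff_add_eq_0)
  then have "(x * (a * r))\<^sup>2 = (y * (v * t))\<^sup>2" by simp
  moreover have "(x * (a * r))\<^sup>2 = x\<^sup>2 * a * (a * r\<^sup>2)"
    by (simp add: power2_eq_square algebra_simps)
  moreover have "a * r\<^sup>2 = a + (1 - v\<^sup>2) * b" using assms(1,3) by simp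
  ultimately show False using nz by (simp add: power_mult_distrib mult.assoc)
qed

theorem theorem17:
  fixes \<phi> :: "ratfun \<Rightarrow> 'k::field"
    and v a b x y d r :: 'k
    and F \<Phi> \<Psi> :: "diagram \<Rightarrow> nat set set set \<Rightarrow> 'k"
    and P I_PR :: "diagram \<Rightarrow> 'k"
    and L1 L2 S1 S2 :: diagram
  assumes "field_hom \<phi>"
    and "v = \<phi> var_v" and "a = \<phi> var_a" and "b = \<phi> var_b" and "x = \<phi> var_x" and "y = \<phi> var_y"
    and "d = (a + (1 - v\<^sup>2) * b) / a" and "r\<^sup>2 = d"
    and "F_rules v a r F"
    and "Phi_rules v a r x y \<Phi>"
    and "Psi_rules v a r x y \<Psi>"
    and "\<And>D J. cts_diagram D J \<Longrightarrow> classical D \<Longrightarrow> \<Phi> D J = F D J \<and> \<Psi> D J = F D J"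
    and "Homflypt_rules v r P"
    and "Paris_Rabenda_rules x y P I_PR"
    and "link_diagram L1" and "classical L1"
    and "link_diagram L2" and "classical L2"
    and "\<not> link_isotopic L1 L2"
    and "tied_distinguished F L1 L2"
    and "\<not> distinguished P L1 L2"
    and "obtained_by_adding_circle L1 S1"
    and "obtained_by_adding_circle L2 S2"
  shows "tied_distinguished \<Phi> S1 S2 \<and> tied_distinguished \<Psi> S1 S2 \<and> \<not> distinguished I_PR S1 S2"
proof -
  note hom = field_hom_simps[OF assms(1)]
  note coeff = variables_nonzero[THEN hom(7), unfolded hom(2-6) assms(2-6)[symmetric]]
  note v = coeff(1) and a = coeff(2)
  have "d \<noteq> 0" using coeff(4) a assms(7) by simp
  then have r: "r \<noteq> 0" using assms(8) by auto
  have "(v - inverse v) * v = v\<^sup>2 - 1"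
    using v by (simp add: left_diff_distrib power2_eq_square)
  with coeff(3) have w: "v - inverse v \<noteq> 0" by auto
  have r2: "r\<^sup>2 = (a + (1 - v\<^sup>2) * b) / a" using assms(7,8) by simp
  then have ar: "a * r\<^sup>2 = a + (1 - v\<^sup>2) * b" using a by simp
  \<comment> \<open>Multiplication by \<open>a * r\<close> leaves \<open>r\<close> only in its
    square, where the definition of \<open>d\<close> can be inserted; the outcome is a multiple of
    \<open>v - inverse v\<close>.\<close>
  have "(1 / r - r) * (a * r) = a - a * r\<^sup>2"
    using r by (simp add: algebra_simps power2_eq_square)
  also have "\<dots> = (v\<^sup>2 - 1) * b" unfolding ar by (simp add: algebra_simps)
  also have "\<dots> = v * b * (v - inverse v)"
    using v by (simp add: algebra_simps power2_eq_square)
  finally have tied: "(1 / r - r) / (v - inverse v) = v * b / (a * r)"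
    using a r w by (simp add: frac_eq_eq)
  \<comment> \<open>The tied circle is the instance \<open>t = b\<close>, the free one
    \<open>t = 1\<close>.\<close>
  have "x + y * (v * b / (a * r)) \<noteq> 0" "x + y * (v / (a * r)) \<noteq> 0"
    using factor_nonzero[OF a r r2, of x y b] factor_nonzero[OF a r r2, of x y 1] coeff(5,6) by simp_all
  then have factors: "x + y * ((1 / r - r) / (v - inverse v)) \<noteq> 0" "x + y * (v / (a * r)) \<noteq> 0"
    by (simp_all add: tied)
  have L: "\<Phi> L (singletons L) = F L (singletons L)" "\<Psi> L (singletons L) = F L (singletons L)"
    if "link_diagram L" "classical L" for L
    using assms(12)[of L "singletons L"] that by simp_all
  have F: "card (components L1) = card (components L2)" "F L1 (singletons L1) \<noteq> F L2 (singletons L2)"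
    and P: "P L1 = P L2"
    using assms(20,21) by (simp_all add: tied_distinguished_def distinguished_def)
  note add1 = assms(22,15) and add2 = assms(23,17)
  have "card (components S1) = card (components S2)"
    using card_components_circle[OF add1] card_components_circle[OF add2] F(1) by simp
  moreover have "\<Phi> S1 (singletons S1) \<noteq> \<Phi> S2 (singletons S2)"
    using Phi_circle[OF add1 assms(10) w] Phi_circle[OF add2 assms(10) w]
      L assms(15-18) F(2) factors(1) by simp
  moreover have "\<Psi> S1 (singletons S1) \<noteq> \<Psi> S2 (singletons S2)"
    using Psi_circle[OF add1 assms(11)] Psi_circle[OF add2 assms(11)]
      L assms(15-18) F(2) factors(2) by simp
  moreover have "I_PR S1 = I_PR S2"
    using Paris_Rabenda_circle[OF add1 assms(13,14,16) w]
      Paris_Rabenda_circle[OF add2 assms(13,14,18) w] P by simp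
  ultimately show ?thesis by (simp add: tied_distinguished_def distinguished_def)
qed

end
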